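(* There is a randomized $4/3$ approximation algorithm for the minimum latency vertex cover problem (MLVC): given a graph $G$, find a bijection $\pi:V(G)\to\{1,\dots,|V(G)|\}$ minimizing $\sum_{(u,v)\in E(G)}\max\{\pi(u),\pi(v)\}$. *)

theory Defs
  imports "HOL-Probability.Probability" "HOL-Computational_Algebra.Polynomial"
begin

section \<open>Minimum latency vertex cover\<close>

text \<open>A graph is a finite simple undirected graph \<open>(V, E)\<close>; edges are two-element sets of vertices.\<close>

definition simple_graph :: "'a set \<Rightarrow> 'a set set \<Rightarrow> bool" where
  "simple_graph V E \<longleftrightarrow> finite V \<and> (\<forall>e\<in>E. e \<subseteq> V \<and> card e = 2)"

definition mlvc_solution :: "'a set \<Rightarrow> ('a \<Rightarrow> nat) \<Rightarrow> bool" where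
  "mlvc_solution V \<pi> \<longleftrightarrow> bij_betw \<pi> V {1..card V}"

definition mlvc_cost :: "'a set set \<Rightarrow> ('a \<Rightarrow> nat) \<Rightarrow> nat" where
  "mlvc_cost E \<pi> = (\<Sum>e\<in>E. Max (\<pi> ` e))"

definition mlvc_opt :: "'a set \<Rightarrow> 'a set set \<Rightarrow> nat" where
  "mlvc_opt V E = (INF \<pi>\<in>{\<pi>. mlvc_solution V \<pi>}. mlvc_cost E \<pi>)"


section \<open>Randomized random access programs\<close>

text \<open>
  The machine model is a unit-cost random access machine with fair coin flips, presented as a
  structured language over scalar variables and arrays of natural numbers. Multiplication is
  deliberately not a primitive: with addition and truncated subtraction only, the values occurring
  in the first \<open>t\<close> steps of a fixed program have bit length linear in \<open>t\<close> and in the bit length of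
  the input, so a polynomial number of steps means polynomial time on a probabilistic Turing
  machine. The expressions of a fixed program have bounded size, so evaluating one counts as a
  single step.
\<close>

type_synonym name = string

record state =
  var :: "name \<Rightarrow> nat"
  arr :: "name \<Rightarrow> nat \<Rightarrow> nat"

datatype aexp =
    Const nat
  | Var name
  | Read name aexp
  | Plus aexp aexp
  | Minus aexp aexp

datatype bexp =
    Less aexp aexp
  | Neg bexp
  | Conj bexp bexp

datatype com =
    SKIP
  | Assign name aexp
  | Store name aexp aexp
  | Flip name
  | Seq com com
  | Cond bexp com com
  | While bexp com

fun aval :: "aexp \<Rightarrow> state \<Rightarrow> nat" where
  "aval (Const k) s = k"
| "aval (Var x) s = var s x"
| "aval (Read a i) s = arr s a (aval i s)"
| "aval (Plus e f) s = aval e s + aval f s"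
| "aval (Minus e f) s = aval e s - aval f s"

fun bval :: "bexp \<Rightarrow> state \<Rightarrow> bool" where
  "bval (Less e f) s \<longleftrightarrow> aval e s < aval f s"
| "bval (Neg b) s \<longleftrightarrow> \<not> bval b s"
| "bval (Conj b b') s \<longleftrightarrow> bval b s \<and> bval b' s"

definition set_var :: "name \<Rightarrow> nat \<Rightarrow> state \<Rightarrow> state" where
  "set_var x k s = s\<lparr>var := (var s)(x := k)\<rparr>"

definition set_arr :: "name \<Rightarrow> nat \<Rightarrow> nat \<Rightarrow> state \<Rightarrow> state" where
  "set_arr a i k s = s\<lparr>arr := (arr s)(a := (arr s a)(i := k))\<rparr>"

text \<open>
  One step of computation, as a distribution on configurations. A program has halted iff its
  remaining command is \<open>SKIP\<close>, which steps to itself.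
\<close>

fun step :: "com \<Rightarrow> state \<Rightarrow> (com \<times> state) pmf" where
  "step SKIP s = return_pmf (SKIP, s)"
| "step (Assign x e) s = return_pmf (SKIP, set_var x (aval e s) s)"
| "step (Store a i e) s = return_pmf (SKIP, set_arr a (aval i s) (aval e s) s)"
| "step (Flip x) s = map_pmf (\<lambda>b. (SKIP, set_var x (of_bool b) s)) (bernoulli_pmf (1/2))"
| "step (Seq c d) s =
     (if c = SKIP then return_pmf (d, s)
      else map_pmf (\<lambda>(c', s'). (Seq c' d, s')) (step c s))"
| "step (Cond b c d) s = return_pmf (if bval b s then c else d, s)"
| "step (While b c) s = return_pmf (if bval b s then Seq c (While b c) else SKIP, s)"

primrec run :: "nat \<Rightarrow> com \<times> state \<Rightarrow> (com \<times> state) pmf" where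
  "run 0 cfg = return_pmf cfg"
| "run (Suc t) cfg = bind_pmf (step (fst cfg) (snd cfg)) (run t)"


section \<open>Approximation algorithms for MLVC\<close>

text \<open>
  The input graph has vertices \<open>0, \<dots>, n - 1\<close> and is presented by a list of its edges, each edge
  occurring once, in arbitrary order and with its endpoints in arbitrary order.
\<close>

definition lists_edges :: "(nat \<times> nat) list \<Rightarrow> nat set set \<Rightarrow> bool" where
  "lists_edges es E \<longleftrightarrow>
     distinct (map (\<lambda>(u, v). {u, v}) es) \<and> set (map (\<lambda>(u, v). {u, v}) es) = E"

definition input_state :: "nat \<Rightarrow> (nat \<times> nat) list \<Rightarrow> state" where
  "input_state n es =
     \<lparr>var = (\<lambda>_. 0)(''n'' := n, ''m'' := length es),
      arr = (\<lambda>_ _. 0)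
        (''u'' := (\<lambda>i. if i < length es then fst (es ! i) else 0),
         ''v'' := (\<lambda>i. if i < length es then snd (es ! i) else 0))\<rparr>"

definition computed_order :: "com \<times> state \<Rightarrow> nat \<Rightarrow> nat" where
  "computed_order cfg = arr (snd cfg) ''pi''"

text \<open>
  A randomized \<open>\<rho>\<close>-approximation algorithm halts within polynomially many steps and returns a
  feasible solution for every outcome of its coin flips; the expected cost of that solution is at
  most \<open>\<rho>\<close> times the optimum. The input size \<open>n + m\<close> counts machine words, each at most the input
  size itself, and is thus polynomially related to the size in bits.
\<close>

definition randomized_mlvc_approximation :: "real \<Rightarrow> com \<Rightarrow> bool" where
  "randomized_mlvc_approximation \<rho> c \<longleftrightarrow>
     (\<exists>p :: nat poly. \<forall>n E es. simple_graph {..<n} E \<longrightarrow> lists_edges es E \<longrightarrow>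
        (let D = run (poly p (n + length es)) (c, input_state n es) in
           (\<forall>cfg\<in>set_pmf D. fst cfg = SKIP \<and> mlvc_solution {..<n} (computed_order cfg)) \<and>
           measure_pmf.expectation D (\<lambda>cfg. real (mlvc_cost E (computed_order cfg)))
             \<le> \<rho> * real (mlvc_opt {..<n} E)))"

end

theory Submission
  imports Defs
begin

text \<open>
  Each edge is split into \<open>K\<close> parallel copies, and every copy is charged to one of its endpoints;
  \<open>L\<close> counts the charges of a vertex. Since the maximum of two positions dominates their averages,
  every order \<open>\<sigma>\<close> costs at least \<open>(\<Sum>w. L w * \<sigma> w) / K\<close>. Local search reassigns single copies until
  no copy is charged to an endpoint whose load exceeds that of the other by more than 1. Cutting
  the sorted loads at every missing value then yields levels on which the load is almost constant
  and such that an edge between two levels is charged entirely to its lower endpoint: this is an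
  approximate dual solution of the density decomposition of the graph.

  Order the levels by decreasing load. The lower bound places the edges charged to a level, on
  average, in the middle of the level. Filling the level from the back, always with a vertex of
  minimal remaining degree, does as well as a random order of the level, whose expected maximum
  lies at 2/3 of the level; hence the ratio 4/3. (So no coin flips are needed.) The loads of a level
  differ by at most \<open>n\<close>, which causes an additive error of order \<open>n\<^sup>3 / K\<close>; for large \<open>K\<close> it is
  below 1/3, and then integrality of the costs removes it.
\<close>

section \<open>Charging edges to endpoints\<close>

text \<open>Edge \<open>i\<close> joins \<open>u i\<close> and \<open>v i\<close>, just as the input
  arrays present it; parallel edges are allowed.\<close>

locale edge_list =
  fixes n m :: nat and u v :: "nat \<Rightarrow> nat"
  assumes u_less: "i < m \<Longrightarrow> u i < n"
    and v_less: "i < m \<Longrightarrow> v i < n"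
    and u_neq_v: "i < m \<Longrightarrow> u i \<noteq> v i"
begin

definition cost :: "(nat \<Rightarrow> nat) \<Rightarrow> nat" where
  "cost \<pi> = (\<Sum>i<m. max (\<pi> (u i)) (\<pi> (v i)))"

text \<open>Of the parallel copies of edge \<open>i\<close>, \<open>x i\<close> are charged to
  \<open>u i\<close> and \<open>y i\<close> to \<open>v i\<close>.\<close>

definition load :: "(nat \<Rightarrow> nat) \<Rightarrow> (nat \<Rightarrow> nat) \<Rightarrow> nat \<Rightarrow> nat" where
  "load x y w = (\<Sum>i<m. (if u i = w then x i else 0) + (if v i = w then y i else 0))"

text \<open>The degree of \<open>w\<close> in the subgraph induced by the positions up to
  \<open>p\<close>; it is 0 if \<open>w\<close> itself lies beyond \<open>p\<close>.\<close>

definition degree_upto :: "(nat \<Rightarrow> nat) \<Rightarrow> nat \<Rightarrow> nat \<Rightarrow> nat" where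
  "degree_upto \<pi> p w = card {i. i < m \<and> (u i = w \<or> v i = w) \<and> \<pi> (u i) \<le> p \<and> \<pi> (v i) \<le> p}"

lemma degree_upto_eq_sum:
  "degree_upto \<pi> p w =
     (\<Sum>i<m. of_bool ((u i = w \<or> v i = w) \<and> \<pi> (u i) \<le> p \<and> \<pi> (v i) \<le> p))"
proof -
  have "{i. i < m \<and> (u i = w \<or> v i = w) \<and> \<pi> (u i) \<le> p \<and> \<pi> (v i) \<le> p} =
     {..<m} \<inter> {i. (u i = w \<or> v i = w) \<and> \<pi> (u i) \<le> p \<and> \<pi> (v i) \<le> p}" by auto
  then show ?thesis by (simp add: degree_upto_def)
qed

lemma sum_load_times:
  "(\<Sum>w<n. load x y w * f w) = (\<Sum>i<m. x i * f (u i) + y i * f (v i))"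
proof -
  have "(\<Sum>w<n. load x y w * f w) =
    (\<Sum>w<n. \<Sum>i<m. (if u i = w then x i * f w else 0) + (if v i = w then y i * f w else 0))"
    unfolding load_def sum_distrib_right by (intro sum.cong refl) (auto simp: algebra_simps)
  also have "\<dots> = (\<Sum>i<m. \<Sum>w<n. (if u i = w then x i * f w else 0) + (if v i = w then y i * f w else 0))"
    by (rule sum.swap)
  also have "\<dots> = (\<Sum>i<m. x i * f (u i) + y i * f (v i))"
    by (intro sum.cong refl) (simp add: sum.distrib u_less v_less)
  finally show ?thesis .
qed

lemma sum_load:
  assumes "\<And>i. i < m \<Longrightarrow> x i + y i = K"
  shows "(\<Sum>w<n. load x y w) = m * K"
  using sum_load_times[of x y "\<lambda>_. 1"] assms by simp

text \<open>Weak duality: \<open>x i\<close> and \<open>y i\<close> are weights of total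
  \<open>K\<close>, and a weighted mean of two positions is at most their maximum. As
  \<open>\<pi>\<close> is arbitrary, this bounds the optimum from below.\<close>

lemma sum_load_le_cost:
  assumes "\<And>i. i < m \<Longrightarrow> x i + y i = K"
  shows "(\<Sum>w<n. load x y w * \<pi> w) \<le> K * cost \<pi>"
proof -
  have "x i * \<pi> (u i) + y i * \<pi> (v i) \<le> K * max (\<pi> (u i)) (\<pi> (v i))" if "i < m" for i
    unfolding assms[OF that, symmetric] add_mult_distrib
    by (intro add_mono mult_left_mono) auto
  then show ?thesis
    unfolding sum_load_times cost_def sum_distrib_left by (intro sum_mono) auto
qed

text \<open>Each edge is accounted for at its later endpoint, which injectivity makes unique. The
  edges accounted for at \<open>w\<close> are those to earlier neighbours.\<close>

lemma cost_eq_sum_degree_upto: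
  assumes inj: "inj_on \<pi> {..<n}"
  shows "cost \<pi> = (\<Sum>w<n. \<pi> w * degree_upto \<pi> (\<pi> w) w)"
proof -
  have "(\<Sum>w<n. \<pi> w * degree_upto \<pi> (\<pi> w) w) =
    (\<Sum>i<m. \<Sum>w<n. \<pi> w * of_bool ((u i = w \<or> v i = w) \<and> \<pi> (u i) \<le> \<pi> w \<and> \<pi> (v i) \<le> \<pi> w))"
    unfolding degree_upto_eq_sum sum_distrib_left by (rule sum.swap)
  also have "\<dots> = (\<Sum>i<m. max (\<pi> (u i)) (\<pi> (v i)))"
  proof (intro sum.cong refl)
    fix i assume "i \<in> {..<m}"
    then have i: "u i < n" "v i < n" "u i \<noteq> v i" by (auto simp: u_less v_less u_neq_v)
    then have ne: "\<pi> (u i) \<noteq> \<pi> (v i)" using inj by (auto dest: inj_onD)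
    define z where "z = (if \<pi> (u i) \<le> \<pi> (v i) then v i else u i)"
    have z: "((u i = w \<or> v i = w) \<and> \<pi> (u i) \<le> \<pi> w \<and> \<pi> (v i) \<le> \<pi> w) \<longleftrightarrow> w = z" for w
      using ne by (auto simp: z_def)
    have "(\<Sum>w<n. \<pi> w * of_bool (w = z)) = (\<Sum>w<n. if w = z then \<pi> z else 0)"
      by (intro sum.cong) auto
    also have "\<dots> = \<pi> z" using i by (auto simp: z_def)
    finally show "(\<Sum>w<n. \<pi> w * of_bool ((u i = w \<or> v i = w) \<and> \<pi> (u i) \<le> \<pi> w \<and> \<pi> (v i) \<le> \<pi> w))
       = max (\<pi> (u i)) (\<pi> (v i))"
      unfolding z by (simp add: z_def)
  qed
  finally show ?thesis by (simp add: cost_def)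
qed

end

section \<open>Rearrangement: decreasing weights minimize the weighted sum of positions\<close>

lemma image_down_closed:
  assumes bij: "bij_betw \<pi> V {1..n :: nat}" and A: "A \<subseteq> V"
    and down: "\<And>a b. a \<in> A \<Longrightarrow> b \<in> V \<Longrightarrow> \<pi> b \<le> \<pi> a \<Longrightarrow> b \<in> A"
  shows "\<pi> ` A = {1..card A}"
proof -
  have fin: "finite V" using bij bij_betw_finite by blast
  have inj: "inj_on \<pi> A" using bij A by (meson bij_betw_def inj_on_subset)
  have img: "\<pi> ` V = {1..n}" using bij by (simp add: bij_betw_def)
  have finA: "finite (\<pi> ` A)" using fin A by (meson finite_imageI finite_subset)
  have card: "card (\<pi> ` A) = card A" using inj by (rule card_image)
  show ?thesis
  proof (cases "A = {}")
    case False
    then have Mx: "Max (\<pi> ` A) \<in> \<pi> ` A" using finA by (intro Max_in) auto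
    \<comment> \<open>Every value below the maximum is attained somewhere on \<open>V\<close>, and
      then on \<open>A\<close> by down-closedness; comparing cardinalities identifies the
      maximum.\<close>
    have "\<pi> ` A = {1..Max (\<pi> ` A)}"
    proof (intro equalityI subsetI)
      fix k assume "k \<in> \<pi> ` A"
      then have "k \<le> Max (\<pi> ` A)" "k \<in> \<pi> ` V" using A finA by auto
      then show "k \<in> {1..Max (\<pi> ` A)}" by (simp add: img)
    next
      fix k assume k: "k \<in> {1..Max (\<pi> ` A)}"
      obtain a where a: "a \<in> A" "\<pi> a = Max (\<pi> ` A)" using Mx by auto
      have "\<pi> a \<in> {1..n}" unfolding img[symmetric] using a A by blast
      then have "k \<in> {1..n}" using k a by auto
      then obtain b where "b \<in> V" "\<pi> b = k" using img by (metis imageE)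
      then show "k \<in> \<pi> ` A" using down[OF a(1)] a k by auto
    qed
    then have "\<pi> ` A = {1..card (\<pi> ` A)}" by (metis card_atLeastAtMost diff_Suc_1)
    then show ?thesis unfolding card .
  qed auto
qed

text \<open>The maximum of \<open>k\<close> distinct positive numbers is at least \<open>k\<close>;
  removing it leaves the same claim for \<open>k - 1\<close>.\<close>

lemma sum_atLeast1_card_le:
  "finite X \<Longrightarrow> (0 :: nat) \<notin> X \<Longrightarrow> \<Sum>{1..card X} \<le> \<Sum>X"
proof (induction "card X" arbitrary: X)
  case (Suc k)
  then have ne: "X \<noteq> {}" by auto
  let ?M = "Max X"
  have M: "?M \<in> X" using Suc ne by auto
  have "X \<subseteq> {1..?M}"
  proof
    fix x assume "x \<in> X"
    then show "x \<in> {1..?M}" using Suc by (cases x) auto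
  qed
  then have "card X \<le> card {1..?M}" by (intro card_mono) auto
  then have "card X \<le> ?M" by simp
  moreover have "k = card (X - {?M})" using Suc M by simp
  then have "\<Sum>{1..k} \<le> \<Sum>(X - {?M})" using Suc(1)[of "X - {?M}"] Suc by auto
  moreover have "\<Sum>X = ?M + \<Sum>(X - {?M})" using Suc M by (simp add: sum.remove)
  ultimately show ?case using Suc(2)[symmetric] by simp
qed simp

text \<open>Layer cake: \<open>h a\<close> counts the thresholds \<open>t < h a\<close>, so both
  sums split over the superlevel sets of \<open>h\<close>. \<open>\<pi>\<close> maps each of them
  onto an initial segment, which has the least sum of positions possible for its size.\<close>

lemma sum_antitone_rearrangement_le:
  fixes h \<pi> \<pi>' :: "'a \<Rightarrow> nat"
  assumes \<pi>: "bij_betw \<pi> V {1..n}" and \<pi>': "bij_betw \<pi>' V {1..n}"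
    and anti: "\<And>a b. a \<in> V \<Longrightarrow> b \<in> V \<Longrightarrow> \<pi> b \<le> \<pi> a \<Longrightarrow> h a \<le> h b"
  shows "(\<Sum>a\<in>V. h a * \<pi> a) \<le> (\<Sum>a\<in>V. h a * \<pi>' a)"
proof -
  have fin: "finite V" using \<pi> bij_betw_finite by blast
  define T where "T = (\<Sum>a\<in>V. h a)"
  have T: "h a \<le> T" if "a \<in> V" for a
    unfolding T_def using that fin by (simp add: member_le_sum)
  have layer: "(\<Sum>a\<in>V. h a * f a) = (\<Sum>t<T. \<Sum>a\<in>{a\<in>V. t < h a}. f a)" for f :: "'a \<Rightarrow> nat"
  proof -
    have "(\<Sum>a\<in>V. h a * f a) = (\<Sum>a\<in>V. \<Sum>t<T. if t < h a then f a else 0)"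
    proof (intro sum.cong refl)
      fix a assume a: "a \<in> V"
      have "{..<T} \<inter> {t. t < h a} = {..<h a}" using T[OF a] by auto
      then show "h a * f a = (\<Sum>t<T. if t < h a then f a else 0)"
        by (simp add: sum.If_cases)
    qed
    also have "\<dots> = (\<Sum>t<T. \<Sum>a\<in>V. if t < h a then f a else 0)" by (rule sum.swap)
    also have "\<dots> = (\<Sum>t<T. \<Sum>a\<in>{a\<in>V. t < h a}. f a)"
      using fin by (simp add: sum.inter_filter)
    finally show ?thesis .
  qed
  have "(\<Sum>a\<in>{a\<in>V. t < h a}. \<pi> a) \<le> (\<Sum>a\<in>{a\<in>V. t < h a}. \<pi>' a)" for t
  proof -
    let ?A = "{a\<in>V. t < h a}"
    have inj: "inj_on \<pi> ?A" "inj_on \<pi>' ?A"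
      using \<pi> \<pi>' by (auto simp: bij_betw_def inj_on_def)
    have "\<pi> ` ?A = {1..card ?A}"
      by (rule image_down_closed[OF \<pi>]) (use anti in \<open>auto intro: less_le_trans\<close>)
    then have "(\<Sum>a\<in>?A. \<pi> a) = \<Sum>{1..card ?A}" using sum.reindex[OF inj(1), of id] by simp
    also have "\<dots> = \<Sum>{1..card (\<pi>' ` ?A)}" using card_image[OF inj(2)] by simp
    also have "\<dots> \<le> \<Sum>(\<pi>' ` ?A)"
    proof (rule sum_atLeast1_card_le)
      have "\<pi>' ` ?A \<subseteq> {1..n}" using \<pi>' by (auto simp: bij_betw_def)
      then show "0 \<notin> \<pi>' ` ?A" using subsetD[of "\<pi>' ` ?A" "{1..n}" 0] by auto
    qed (use fin in simp)
    also have "\<dots> = (\<Sum>a\<in>?A. \<pi>' a)" using sum.reindex[OF inj(2), of id] by simp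
    finally show ?thesis .
  qed
  then show ?thesis unfolding layer by (rule sum_mono)
qed

section \<open>Cost of a greedy order, level by level\<close>

context edge_list
begin

text \<open>The second conjunct reads from the back: among the vertices of its level at or before
  its position, \<open>w\<close> has the least degree in the graph that remains once all later
  vertices are deleted.\<close>

definition greedy_order :: "(nat \<Rightarrow> nat) \<Rightarrow> (nat \<Rightarrow> nat) \<Rightarrow> bool" where
  "greedy_order h \<pi> \<longleftrightarrow> (\<forall>w<n. \<forall>w'<n. \<pi> w' \<le> \<pi> w \<longrightarrow>
     h w \<le> h w' \<and> (h w = h w' \<longrightarrow> degree_upto \<pi> (\<pi> w) w \<le> degree_upto \<pi> (\<pi> w) w'))"

text \<open>Handshaking: an edge is counted at most at its two endpoints, and only if an endpoint in
  \<open>A\<close> pushes its later endpoint beyond \<open>s\<close> while both stay within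
  \<open>p\<close>.\<close>

lemma sum_degree_upto_le:
  assumes fin: "finite A" and A: "\<And>w. w \<in> A \<Longrightarrow> s < \<pi> w"
  shows "(\<Sum>w\<in>A. degree_upto \<pi> p w) \<le>
     2 * card {i. i < m \<and> s < max (\<pi> (u i)) (\<pi> (v i)) \<and> max (\<pi> (u i)) (\<pi> (v i)) \<le> p}"
    (is "_ \<le> 2 * card ?Q")
proof -
  have "(\<Sum>w\<in>A. degree_upto \<pi> p w) =
    (\<Sum>i<m. \<Sum>w\<in>A. of_bool ((u i = w \<or> v i = w) \<and> \<pi> (u i) \<le> p \<and> \<pi> (v i) \<le> p))"
    unfolding degree_upto_eq_sum by (rule sum.swap)
  also have "\<dots> \<le> (\<Sum>i<m. 2 * of_bool (i \<in> ?Q))"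
  proof (intro sum_mono)
    fix i assume i: "i \<in> {..<m}"
    let ?S = "A \<inter> {w. (u i = w \<or> v i = w) \<and> \<pi> (u i) \<le> p \<and> \<pi> (v i) \<le> p}"
    have "(\<Sum>w\<in>A. of_bool ((u i = w \<or> v i = w) \<and> \<pi> (u i) \<le> p \<and> \<pi> (v i) \<le> p)) = card ?S"
      using fin by simp
    also have "\<dots> \<le> 2 * of_bool (i \<in> ?Q)"
    proof (cases "i \<in> ?Q")
      case True
      have "card ?S \<le> card {u i, v i}" by (intro card_mono) auto
      also have "\<dots> \<le> 2" by (simp add: card_insert_if)
      finally show ?thesis using True by simp
    next
      case False
      have "?S = {}" using A False i by fastforce
      then show ?thesis by simp
    qed
    finally show "(\<Sum>w\<in>A. of_bool ((u i = w \<or> v i = w) \<and> \<pi> (u i) \<le> p \<and> \<pi> (v i) \<le> p))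
       \<le> (2 * of_bool (i \<in> ?Q) :: nat)" .
  qed
  also have "\<dots> = 2 * (\<Sum>i<m. of_bool (i \<in> ?Q))" by (simp only: sum_distrib_left)
  also have "(\<Sum>i<m. of_bool (i \<in> ?Q)) = card ({..<m} \<inter> ?Q)"
    by (simp only: sum_of_bool_eq finite_lessThan Collect_mem_eq of_nat_id)
  also have "{..<m} \<inter> ?Q = ?Q" by auto
  finally show ?thesis .
qed

text \<open>With \<open>b = card B\<close>, the bound grants every edge whose later endpoint lies in
  the level the average position \<open>s + 2 * (b + 1) / 3\<close>; here
  \<open>2 * (b + 1) / 3\<close> is the expected maximum of two distinct random elements of
  \<open>{1..b}\<close>. The proof is by induction on the first \<open>j\<close> positions of the
  level.\<close>

lemma block_cost_le:
  assumes bij: "bij_betw \<pi> {..<n} {1..n}" and greedy: "greedy_order h \<pi>"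
    and B: "B = {w. w < n \<and> h w = t}" and s: "s = card {w. w < n \<and> t < h w}"
  shows "\<pi> ` B = {s+1..s + card B}"
    and "3 * (\<Sum>w\<in>B. \<pi> w * degree_upto \<pi> (\<pi> w) w) \<le>
      card {i. i < m \<and> s < max (\<pi> (u i)) (\<pi> (v i)) \<and> max (\<pi> (u i)) (\<pi> (v i)) \<le> s + card B}
        * (3 * s + 2 * (card B + 1))"
proof -
  let ?S = "{w. w < n \<and> t < h w}"
  have g: "h w \<le> h w'" "h w = h w' \<Longrightarrow> degree_upto \<pi> (\<pi> w) w \<le> degree_upto \<pi> (\<pi> w) w'"
    if "w < n" "w' < n" "\<pi> w' \<le> \<pi> w" for w w'
    using greedy that unfolding greedy_order_def by blast+
  have inj: "inj_on \<pi> {..<n}" using bij by (simp add: bij_betw_def)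
  have finB: "finite B" by (simp add: B)
  have S: "\<pi> ` ?S = {1..s}"
    unfolding s by (rule image_down_closed[OF bij]) (use g in \<open>auto intro: less_le_trans\<close>)
  have "\<pi> ` (?S \<union> B) = {1..card (?S \<union> B)}"
  proof (rule image_down_closed[OF bij])
    fix a b assume "a \<in> ?S \<union> B" "b \<in> {..<n}" "\<pi> b \<le> \<pi> a"
    then show "b \<in> ?S \<union> B" using g(1)[of a b] by (auto simp: B)
  qed (auto simp: B)
  also have "card (?S \<union> B) = s + card B"
    unfolding s by (rule card_Un_disjoint) (auto simp: B)
  finally have SB: "\<pi> ` (?S \<union> B) = {1..s + card B}" .
  have "\<pi> ` B = \<pi> ` ((?S \<union> B) - ?S)" by (rule arg_cong[where f = "image \<pi>"]) (auto simp: B)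
  also have "\<dots> = \<pi> ` (?S \<union> B) - \<pi> ` ?S"
    by (rule inj_on_image_set_diff[OF inj]) (auto simp: B)
  also have "\<dots> = {s+1..s + card B}" unfolding S SB by auto
  finally show img: "\<pi> ` B = {s+1..s + card B}" .
  have range: "s < \<pi> w" "\<pi> w \<le> s + card B" if "w \<in> B" for w
    using imageI[OF that, of \<pi>] by (simp_all add: img)
  define M where "M i = max (\<pi> (u i)) (\<pi> (v i))" for i
  define q where "q j = card {i. i < m \<and> s < M i \<and> M i \<le> s + j}" for j
  define A where "A j = {w\<in>B. \<pi> w \<le> s + j}" for j
  have "3 * (\<Sum>w\<in>A j. \<pi> w * degree_upto \<pi> (\<pi> w) w) \<le> q j * (3 * s + 2 * (j + 1))"
    if "j \<le> card B" for j
    using that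
  proof (induction j)
    case 0
    have "A 0 = {}" using range by (auto simp: A_def not_le)
    then show ?case by simp
  next
    case (Suc j)
    then have "s + Suc j \<in> \<pi> ` B" by (simp add: img)
    then obtain z where z: "z \<in> B" "\<pi> z = s + Suc j" by (metis imageE)
    have zn: "z < n" using z by (simp add: B)
    define D where "D = degree_upto \<pi> (\<pi> z) z"
    have A_Suc: "A (Suc j) = insert z (A j)" "z \<notin> A j"
      using z inj by (auto simp: A_def B le_Suc_eq inj_on_def)
    have finA: "finite (A j)" for j using finB by (simp add: A_def)
    have cardA: "card (A (Suc j)) = Suc j"
    proof -
      have "\<pi> ` A (Suc j) = {s+1..s + Suc j}"
      proof -
        have "\<pi> ` A (Suc j) = \<pi> ` B \<inter> {..s + Suc j}" by (auto simp: A_def)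
        then show ?thesis using Suc.prems by (auto simp: img)
      qed
      moreover have "inj_on \<pi> (A (Suc j))" using inj by (auto simp: A_def B inj_on_def)
      ultimately show ?thesis using card_image by fastforce
    qed
    \<comment> \<open>By injectivity, the edges at \<open>z\<close> within the positions up to
      \<open>\<pi> z\<close> are those whose later endpoint is \<open>z\<close>. Hence
      \<open>D\<close> counts the edges that are new in \<open>q (Suc j)\<close>.\<close>
    have Dset: "{i. i < m \<and> (u i = z \<or> v i = z) \<and> \<pi> (u i) \<le> \<pi> z \<and> \<pi> (v i) \<le> \<pi> z} = {i. i < m \<and> M i = s + Suc j}"
    proof -
      have "((u i = z \<or> v i = z) \<and> \<pi> (u i) \<le> \<pi> z \<and> \<pi> (v i) \<le> \<pi> z) \<longleftrightarrow> M i = s + Suc j" if "i < m" for i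
      proof -
        have "\<pi> (u i) = \<pi> z \<longleftrightarrow> u i = z" "\<pi> (v i) = \<pi> z \<longleftrightarrow> v i = z"
          using inj zn u_less[OF that] v_less[OF that] by (auto simp: inj_on_def)
        then show ?thesis unfolding M_def z(2)[symmetric] by (auto simp: max_def)
      qed
      then show ?thesis by blast
    qed
    have q_Suc: "q (Suc j) = q j + D"
    proof -
      have "{i. i < m \<and> s < M i \<and> M i \<le> s + Suc j} =
        {i. i < m \<and> s < M i \<and> M i \<le> s + j} \<union> {i. i < m \<and> M i = s + Suc j}" by auto
      moreover have "card ({i. i < m \<and> s < M i \<and> M i \<le> s + j} \<union> {i. i < m \<and> M i = s + Suc j})
        = q j + card {i. i < m \<and> M i = s + Suc j}"
        unfolding q_def by (rule card_Un_disjoint) auto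
      ultimately show ?thesis unfolding q_def D_def degree_upto_def Dset by simp
    qed
    \<comment> \<open>\<open>z\<close> has the least degree among the \<open>Suc j\<close> vertices
      of \<open>A (Suc j)\<close>; by handshaking these degrees add up to at most
      \<open>2 * q (Suc j)\<close>.\<close>
    have "Suc j * D = (\<Sum>w\<in>A (Suc j). D)" by (simp add: cardA)
    also have "\<dots> \<le> (\<Sum>w\<in>A (Suc j). degree_upto \<pi> (s + Suc j) w)"
    proof (rule sum_mono)
      fix w assume "w \<in> A (Suc j)"
      then have "w < n" "\<pi> w \<le> \<pi> z" "h z = h w" using z by (auto simp: A_def B)
      then show "D \<le> degree_upto \<pi> (s + Suc j) w" using g(2)[OF zn] z by (simp add: D_def)
    qed
    also have "\<dots> \<le> 2 * q (Suc j)"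
      unfolding q_def M_def using range by (intro sum_degree_upto_le finA) (simp add: A_def)
    finally have avg: "Suc j * D \<le> 2 * q (Suc j)" .
    have "3 * (\<Sum>w\<in>A (Suc j). \<pi> w * degree_upto \<pi> (\<pi> w) w) =
       3 * ((s + Suc j) * D) + 3 * (\<Sum>w\<in>A j. \<pi> w * degree_upto \<pi> (\<pi> w) w)"
      using A_Suc finA z by (simp add: D_def)
    also have "\<dots> \<le> 3 * ((s + Suc j) * D) + q j * (3 * s + 2 * (j + 1))"
      using Suc by simp
    \<comment> \<open>A new edge costs \<open>3 * (s + Suc j)\<close>, which exceeds the old
      allowance \<open>3 * s + 2 * (j + 1)\<close> by \<open>Suc j\<close>. The total excess
      \<open>Suc j * D\<close> is paid by raising the allowance of all edges by 2.\<close>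
    also have "\<dots> = q (Suc j) * (3 * s + 2 * (j + 1)) + Suc j * D"
      unfolding q_Suc by (simp add: algebra_simps)
    also have "\<dots> \<le> q (Suc j) * (3 * s + 2 * (Suc j + 1))"
      using avg by (simp add: algebra_simps)
    finally show ?case .
  qed
  from this[of "card B"]
  have "3 * (\<Sum>w\<in>A (card B). \<pi> w * degree_upto \<pi> (\<pi> w) w) \<le> q (card B) * (3 * s + 2 * (card B + 1))"
    by simp
  moreover have "A (card B) = B" using range by (auto simp: A_def)
  ultimately show "3 * (\<Sum>w\<in>B. \<pi> w * degree_upto \<pi> (\<pi> w) w) \<le>
      card {i. i < m \<and> s < max (\<pi> (u i)) (\<pi> (v i)) \<and> max (\<pi> (u i)) (\<pi> (v i)) \<le> s + card B}
        * (3 * s + 2 * (card B + 1))"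
    by (simp add: q_def M_def)
qed

text \<open>\<open>h\<close> replaces the loads by a weight that is constant on each level. The
  edges whose later endpoint lies in a level are charged only inside that level, so its total weight
  bounds their number.\<close>

lemma greedy_cost_le:
  assumes bij: "bij_betw \<pi> {..<n} {1..n}" and greedy: "greedy_order h \<pi>"
    and split: "\<And>i. i < m \<Longrightarrow> x i + y i = K"
    and le: "\<And>w. w < n \<Longrightarrow> load x y w \<le> h w"
    and cut: "\<And>i. i < m \<Longrightarrow> h (v i) < h (u i) \<Longrightarrow> x i = 0"
      "\<And>i. i < m \<Longrightarrow> h (u i) < h (v i) \<Longrightarrow> y i = 0"
  shows "3 * K * cost \<pi> \<le> 4 * (\<Sum>w<n. h w * \<pi> w)"
proof -
  have inj: "inj_on \<pi> {..<n}" using bij by (simp add: bij_betw_def)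
  have blk: "3 * K * (\<Sum>w\<in>{w\<in>{..<n}. h w = t}. \<pi> w * degree_upto \<pi> (\<pi> w) w)
      \<le> 4 * (\<Sum>w\<in>{w\<in>{..<n}. h w = t}. h w * \<pi> w)" for t
  proof -
    define B where "B = {w. w < n \<and> h w = t}"
    define s where "s = card {w. w < n \<and> t < h w}"
    define b where "b = card B"
    define Q where "Q = {i. i < m \<and> s < max (\<pi> (u i)) (\<pi> (v i)) \<and> max (\<pi> (u i)) (\<pi> (v i)) \<le> s + b}"
    note block = block_cost_le[OF bij greedy B_def s_def]
    have img: "\<pi> ` B = {s+1..s+b}" using block(1) by (simp add: b_def)
    have finB: "finite B" by (simp add: B_def)
    have injB: "inj_on \<pi> B" using inj by (auto simp: B_def inj_on_def)
    have memB: "w \<in> B \<longleftrightarrow> s < \<pi> w \<and> \<pi> w \<le> s + b" if "w < n" for w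
    proof -
      have "w \<in> B \<longleftrightarrow> \<pi> w \<in> \<pi> ` B" 
        using inj_on_image_mem_iff[OF inj, of w B] that by (auto simp: B_def)
      then show ?thesis by (auto simp: img)
    qed
    have anti: "h w \<le> h w'" if "w < n" "w' < n" "\<pi> w' \<le> \<pi> w" for w w'
      using greedy that unfolding greedy_order_def by blast
    \<comment> \<open>If one endpoint of an edge in \<open>Q\<close> is outside \<open>B\<close>, it
      comes earlier and so has larger \<open>h\<close>; then \<open>cut\<close> charges all
      \<open>K\<close> copies to the endpoint in \<open>B\<close>.\<close>
    have "K * card Q = (\<Sum>i\<in>Q. K)" by simp
    also have "\<dots> \<le> (\<Sum>i\<in>Q. x i * of_bool (u i \<in> B) + y i * of_bool (v i \<in> B))"
    proof (rule sum_mono)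
      fix i assume i: "i \<in> Q"
      then have im: "i < m" and mx: "s < max (\<pi> (u i)) (\<pi> (v i))" "max (\<pi> (u i)) (\<pi> (v i)) \<le> s + b"
        by (auto simp: Q_def)
      have un: "u i < n" and vn: "v i < n" using im by (auto simp: u_less v_less)
      show "K \<le> x i * of_bool (u i \<in> B) + y i * of_bool (v i \<in> B)"
      proof (cases "\<pi> (u i) \<le> \<pi> (v i)")
        case True
        then have vB: "v i \<in> B" using mx memB[OF vn] by (auto simp: max_def)
        show ?thesis
        proof (cases "u i \<in> B")
          case False
          then have "h (v i) < h (u i)" using anti[OF vn un True] vB un by (auto simp: B_def)
          then show ?thesis using cut(1)[OF im] split[OF im] vB by simp
        qed (use vB split[OF im] in auto)
      next
        case F: False
        then have uB: "u i \<in> B" using mx memB[OF un] by (auto simp: max_def)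
        show ?thesis
        proof (cases "v i \<in> B")
          case False
          then have "h (u i) < h (v i)" using anti[OF un vn] F uB vn by (auto simp: B_def)
          then show ?thesis using cut(2)[OF im] split[OF im] uB by simp
        qed (use uB split[OF im] in auto)
      qed
    qed
    also have "\<dots> \<le> (\<Sum>i<m. x i * of_bool (u i \<in> B) + y i * of_bool (v i \<in> B))"
      by (rule sum_mono2) (auto simp: Q_def)
    also have "\<dots> = (\<Sum>w<n. load x y w * of_bool (w \<in> B))"
      using sum_load_times[of x y "\<lambda>w. of_bool (w \<in> B)"] by simp
    also have "\<dots> \<le> (\<Sum>w<n. t * of_bool (w \<in> B))"
      using le by (intro sum_mono) (auto simp: B_def)
    also have "\<dots> = t * b"
    proof -
      have "{..<n} \<inter> B = B" by (auto simp: B_def)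
      then show ?thesis by (simp add: b_def flip: sum_distrib_left)
    qed
    finally have KQ: "K * card Q \<le> t * b" .
    have "3 * K * (\<Sum>w\<in>B. \<pi> w * degree_upto \<pi> (\<pi> w) w) = K * (3 * (\<Sum>w\<in>B. \<pi> w * degree_upto \<pi> (\<pi> w) w))"
      by (simp add: algebra_simps)
    also have "\<dots> \<le> K * (card Q * (3 * s + 2 * (b + 1)))"
      using block(2) unfolding Q_def b_def by (intro mult_left_mono) auto
    also have "\<dots> \<le> t * b * (3 * s + 2 * (b + 1))"
      using mult_right_mono[OF KQ, of "3 * s + 2 * (b + 1)"] by (simp only: mult.assoc)
    \<comment> \<open>Only \<open>3 * s\<close> is relaxed to \<open>4 * s\<close>. For
      \<open>s = 0\<close> there is equality: \<open>2 * (b + 1) / 3\<close> is exactly 4/3 of the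
      mean position \<open>(b + 1) / 2\<close>.\<close>
    also have "\<dots> \<le> t * (2 * b * (2 * s + b + 1))"
    proof -
      have "b * (3 * s + 2 * (b + 1)) \<le> 2 * b * (2 * s + b + 1)" by (simp add: algebra_simps)
      from mult_left_mono[OF this, of t] show ?thesis by (simp only: mult.assoc zero_le)
    qed
    also have "2 * b * (2 * s + b + 1) = 4 * \<Sum>{s+1..s+b}"
      by (induction b) (simp_all add: algebra_simps)
    also have "\<Sum>{s+1..s+b} = (\<Sum>w\<in>B. \<pi> w)"
      unfolding img[symmetric] using sum.reindex[OF injB, of id] by simp
    also have "t * (4 * (\<Sum>w\<in>B. \<pi> w)) = 4 * (\<Sum>w\<in>B. h w * \<pi> w)"
      by (simp add: B_def sum_distrib_left algebra_simps)
    finally show ?thesis by (simp add: B_def)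
  qed
  have "3 * K * cost \<pi> = (\<Sum>t\<in>h ` {..<n}. 3 * K * (\<Sum>w\<in>{w\<in>{..<n}. h w = t}. \<pi> w * degree_upto \<pi> (\<pi> w) w))"
    unfolding cost_eq_sum_degree_upto[OF inj]
    by (simp add: sum.image_gen[of "{..<n}" "\<lambda>w. \<pi> w * degree_upto \<pi> (\<pi> w) w" h] sum_distrib_left)
  also have "\<dots> \<le> (\<Sum>t\<in>h ` {..<n}. 4 * (\<Sum>w\<in>{w\<in>{..<n}. h w = t}. h w * \<pi> w))"
    by (intro sum_mono blk)
  also have "\<dots> = 4 * (\<Sum>w<n. h w * \<pi> w)"
    by (simp add: sum.image_gen[of "{..<n}" "\<lambda>w. h w * \<pi> w" h] sum_distrib_left)
  finally show ?thesis .
qed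

section \<open>Stable charges, and levels cut at missing loads\<close>

definition stable :: "(nat \<Rightarrow> nat) \<Rightarrow> (nat \<Rightarrow> nat) \<Rightarrow> (nat \<Rightarrow> nat) \<Rightarrow> nat \<Rightarrow> bool" where
  "stable l x y i \<longleftrightarrow>
     (l (v i) + 1 < l (u i) \<longrightarrow> x i = 0) \<and> (l (u i) + 1 < l (v i) \<longrightarrow> y i = 0)"

text \<open>\<open>t\<close> is the last value of the run of consecutive loads that starts at
  \<open>l w\<close>. Vertices of one run share it, so it can name their level.\<close>

definition gap_level :: "(nat \<Rightarrow> nat) \<Rightarrow> nat \<Rightarrow> nat \<Rightarrow> bool" where
  "gap_level l w t \<longleftrightarrow> l w \<le> t \<and> {l w<..t} \<subseteq> l ` {..<n} \<and> t + 1 \<notin> l ` {..<n}"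

text \<open>The run contains \<open>t - l w\<close> distinct loads, and \<open>n\<close> vertices
  take at most \<open>n\<close> values.\<close>

lemma run_of_loads_le:
  assumes "{l w<..t} \<subseteq> l ` {..<n}"
  shows "t \<le> l w + n"
proof -
  have "card {l w<..t} \<le> card (l ` {..<n})" using assms by (intro card_mono) auto
  also have "\<dots> \<le> n" using card_image_le[of "{..<n}" l] by simp
  finally show ?thesis by simp
qed

text \<open>The missing value \<open>h w + 1\<close> separates the levels, so their loads differ by
  at least 2. This turns \<open>stable\<close> into the assumption \<open>cut\<close> of
  \<open>greedy_cost_le\<close>.\<close>

lemma gap_level_less:
  assumes "gap_level l w (h w)" "gap_level l w' (h w')" "h w < h w'" "w' < n"
  shows "l w + 1 < l w'"
proof -
  have "h w < l w'"
  proof (rule ccontr)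
    assume "\<not> h w < l w'"
    then have "h w + 1 \<in> {l w'<..h w'}" using assms by auto
    then show False using assms unfolding gap_level_def by blast
  qed
  moreover have "l w' \<noteq> h w + 1" 
  proof
    assume "l w' = h w + 1"
    then have "h w + 1 \<in> l ` {..<n}" using imageI[of w' "{..<n}" l] assms(4) by simp
    then show False using assms(1) by (simp add: gap_level_def)
  qed
  ultimately show ?thesis using assms unfolding gap_level_def by linarith
qed

theorem greedy_approximation:
  assumes bij: "bij_betw \<pi> {..<n} {1..n}" and greedy: "greedy_order h \<pi>"
    and split: "\<And>i. i < m \<Longrightarrow> x i + y i = K"
    and stable: "\<And>i. i < m \<Longrightarrow> stable (load x y) x y i"
    and level: "\<And>w. w < n \<Longrightarrow> gap_level (load x y) w (h w)"
    and K: "2 * n * n * (n + 1) < K"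
    and bij': "bij_betw \<pi>' {..<n} {1..n}"
  shows "3 * cost \<pi> \<le> 4 * cost \<pi>'"
proof -
  let ?l = "load x y"
  have "3 * K * cost \<pi> \<le> 4 * (\<Sum>w<n. h w * \<pi> w)"
  proof (rule greedy_cost_le[OF bij greedy split])
    show "?l w \<le> h w" if "w < n" for w using level[OF that] by (simp add: gap_level_def)
    show "x i = 0" if "i < m" "h (v i) < h (u i)" for i
      using stable[OF that(1)] gap_level_less[OF level level that(2)] that(1)
      by (auto simp: stable_def u_less v_less)
    show "y i = 0" if "i < m" "h (u i) < h (v i)" for i
      using stable[OF that(1)] gap_level_less[OF level level that(2)] that(1)
      by (auto simp: stable_def u_less v_less)
  qed
  \<comment> \<open>\<open>h\<close> is antitone along \<open>\<pi>\<close>, so the other order can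
    only raise the weighted sum. Only afterwards is \<open>h\<close> replaced by the loads, whose
    order \<open>\<pi>\<close> need not respect.\<close>
  also have "(\<Sum>w<n. h w * \<pi> w) \<le> (\<Sum>w<n. h w * \<pi>' w)"
    using greedy by (intro sum_antitone_rearrangement_le[OF bij bij']) (auto simp: greedy_order_def)
  also have "\<dots> \<le> (\<Sum>w<n. (?l w + n) * \<pi>' w)"
    using level by (intro sum_mono mult_right_mono) (auto simp: gap_level_def run_of_loads_le)
  also have "\<dots> = (\<Sum>w<n. ?l w * \<pi>' w) + n * (\<Sum>w<n. \<pi>' w)"
    by (simp add: algebra_simps sum.distrib sum_distrib_left)
  also have "(\<Sum>w<n. \<pi>' w) = \<Sum>{1..n}" using sum.reindex_bij_betw[OF bij', of id] by simp
  also have "(\<Sum>w<n. ?l w * \<pi>' w) \<le> K * cost \<pi>'" by (rule sum_load_le_cost[OF split])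
  finally have "3 * K * cost \<pi> \<le> 4 * (K * cost \<pi>' + n * \<Sum>{1..n})" by simp
  \<comment> \<open>The error term equals \<open>2 * n * n * (n + 1)\<close>; being below
    \<open>K\<close>, it vanishes by integrality after division by \<open>K\<close>.\<close>
  also have "4 * (K * cost \<pi>' + n * \<Sum>{1..n}) = 4 * K * cost \<pi>' + 2 * n * (2 * \<Sum>{1..n})" by simp
  also have "2 * \<Sum>{1..n} = n * (n + 1)" by (induction n) auto
  also have "4 * K * cost \<pi>' + 2 * n * (n * (n + 1)) < K * (4 * cost \<pi>' + 1)"
    using K by (simp add: algebra_simps)
  finally have "K * (3 * cost \<pi>) < K * (4 * cost \<pi>' + 1)" by (simp add: algebra_simps)
  then have "3 * cost \<pi> < 4 * cost \<pi>' + 1" by (simp only: mult_less_cancel1)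
  then show ?thesis by simp
qed

end


section \<open>Timed reachability for deterministic programs\<close>

text \<open>Excluding \<open>SKIP\<close> before every step lets a chain of \<open>c\<close> lift to
  \<open>Seq c d\<close>, where a finished first component hands over to \<open>d\<close> instead of
  stepping to itself.\<close>

primrec chain :: "nat \<Rightarrow> com \<times> state \<Rightarrow> com \<times> state \<Rightarrow> bool" where
  "chain 0 a b \<longleftrightarrow> a = b"
| "chain (Suc t) a b \<longleftrightarrow>
     fst a \<noteq> SKIP \<and> (\<exists>a'. step (fst a) (snd a) = return_pmf a' \<and> chain t a' b)"

lemma chain_trans: "chain t a b \<Longrightarrow> chain t' b c \<Longrightarrow> chain (t + t') a c"
  by (induction t arbitrary: a) auto

lemma chain_Seq: "chain t (c, s) (c', s') \<Longrightarrow> chain t (Seq c d, s) (Seq c' d, s')"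
proof (induction t arbitrary: c s)
  case (Suc t)
  then obtain a where "c \<noteq> SKIP" "step c s = return_pmf a" "chain t a (c', s')" by auto
  then show ?case using Suc.IH[of "fst a" "snd a"] by (cases a) auto
qed simp

lemma chain_run: "chain t a b \<Longrightarrow> run (t + k) a = run k b"
  by (induction t arbitrary: a) (auto simp: bind_return_pmf)

lemma run_SKIP: "run k (SKIP, s) = return_pmf (SKIP, s)"
  by (induction k) (simp_all add: bind_return_pmf)

text \<open>A timed total-correctness triple; \<open>T\<close> is only an upper bound, as branches
  and loops take state-dependent time.\<close>

definition reach :: "com \<Rightarrow> state \<Rightarrow> nat \<Rightarrow> (state \<Rightarrow> bool) \<Rightarrow> bool" where
  "reach c s T Q \<longleftrightarrow> (\<exists>t\<le>T. \<exists>s'. chain t (c, s) (SKIP, s') \<and> Q s')"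

text \<open>Since \<open>SKIP\<close> steps to itself, idling up to step \<open>T\<close> changes
  nothing.\<close>

lemma reach_run:
  assumes "reach c s T Q"
  obtains s' where "run T (c, s) = return_pmf (SKIP, s')" "Q s'"
proof -
  from assms obtain t s' where *: "t \<le> T" "chain t (c, s) (SKIP, s')" "Q s'"
    by (auto simp: reach_def)
  then have "run T (c, s) = return_pmf (SKIP, s')"
    using chain_run[OF *(2), of "T - t"] by (simp add: run_SKIP)
  then show ?thesis using *(3) by (rule that)
qed

lemma reach_mono: "reach c s T Q \<Longrightarrow> T \<le> T' \<Longrightarrow> (\<And>s'. Q s' \<Longrightarrow> Q' s') \<Longrightarrow> reach c s T' Q'"
  unfolding reach_def by (meson le_trans)

text \<open>The extra step is the one from \<open>Seq SKIP d\<close> to \<open>d\<close>.\<close>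

lemma reach_Seq:
  assumes "reach c s T (\<lambda>s'. reach d s' T' Q)"
  shows "reach (Seq c d) s (T + T' + 1) Q"
proof -
  from assms obtain t s1 t' s2 where
    *: "t \<le> T" "chain t (c, s) (SKIP, s1)" "t' \<le> T'" "chain t' (d, s1) (SKIP, s2)" "Q s2"
    by (auto simp: reach_def)
  have "chain (t + Suc t') (Seq c d, s) (SKIP, s2)"
    by (rule chain_trans[OF chain_Seq[OF *(2)]]) (use * in auto)
  then show ?thesis unfolding reach_def using * by (intro exI[of _ "t + Suc t'"]) auto
qed

lemma reach_step:
  assumes "c \<noteq> SKIP" "step c s = return_pmf (c', s')" "reach c' s' T Q"
  shows "reach c s (T + 1) Q"
proof -
  from assms(3) obtain t s'' where *: "t \<le> T" "chain t (c', s') (SKIP, s'')" "Q s''"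
    by (auto simp: reach_def)
  then have "chain (Suc t) (c, s) (SKIP, s'')" using assms by auto
  then show ?thesis unfolding reach_def using * by (intro exI[of _ "Suc t"]) auto
qed

lemma reach_SKIP: "Q s \<Longrightarrow> reach SKIP s T Q"
  unfolding reach_def by (intro exI[of _ 0]) auto

lemma reach_Assign: "Q (set_var x (aval e s) s) \<Longrightarrow> reach (Assign x e) s 1 Q"
  using reach_step[of "Assign x e" s SKIP "set_var x (aval e s) s" 0 Q] by (simp add: reach_SKIP)

lemma reach_Store: "Q (set_arr a (aval i s) (aval e s) s) \<Longrightarrow> reach (Store a i e) s 1 Q"
  using reach_step[of "Store a i e" s SKIP "set_arr a (aval i s) (aval e s) s" 0 Q]
  by (simp add: reach_SKIP)

section \<open>Symbolic evaluation of straight-line code\<close>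

fun straight :: "com \<Rightarrow> bool" where
  "straight SKIP = True"
| "straight (Assign x e) = True"
| "straight (Store a i e) = True"
| "straight (Flip x) = False"
| "straight (Seq c d) = (straight c \<and> straight d)"
| "straight (Cond b c d) = (straight c \<and> straight d)"
| "straight (While b c) = False"

text \<open>A functional semantics that simplification can evaluate. The last equation is meant for
  \<open>SKIP\<close>; on \<open>Flip\<close> and \<open>While\<close>, which
  \<open>straight\<close> excludes, it is a dummy.\<close>

fun exec :: "com \<Rightarrow> state \<Rightarrow> state" where
  "exec (Assign x e) s = set_var x (aval e s) s"
| "exec (Store a i e) s = set_arr a (aval i s) (aval e s) s"
| "exec (Seq c d) s = exec d (exec c s)"
| "exec (Cond b c d) s = (if bval b s then exec c s else exec d s)"
| "exec _ s = s"

fun duration :: "com \<Rightarrow> nat" where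
  "duration (Seq c d) = duration c + duration d + 1"
| "duration (Cond b c d) = duration c + duration d + 1"
| "duration _ = 1"

lemma reach_straight: "straight c \<Longrightarrow> Q (exec c s) \<Longrightarrow> reach c s (duration c) Q"
proof (induction c arbitrary: s Q)
  case (Seq c d)
  then have "reach c s (duration c) (\<lambda>s'. reach d s' (duration d) Q)" by auto
  then show ?case using reach_Seq by simp
next
  case (Cond b c d)
  have "reach (if bval b s then c else d) s (duration c + duration d) Q"
  proof (cases "bval b s")
    case True
    then have "reach c s (duration c) Q" using Cond by simp
    then show ?thesis unfolding if_P[OF True] by (rule reach_mono) auto
  next
    case False
    then have "reach d s (duration d) Q" using Cond by simp
    then show ?thesis unfolding if_not_P[OF False] by (rule reach_mono) auto
  qed
  then have "reach (Cond b c d) s (duration c + duration d + 1) Q"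
    by (rule reach_step[rotated 2]) simp_all
  then show ?case by simp
qed (auto intro: reach_SKIP reach_Assign[simplified] reach_Store[simplified])

section \<open>Frame conditions and timed loop rules\<close>

fun mod_vars :: "com \<Rightarrow> name set" where
  "mod_vars (Assign x e) = {x}"
| "mod_vars (Flip x) = {x}"
| "mod_vars (Seq c d) = mod_vars c \<union> mod_vars d"
| "mod_vars (Cond b c d) = mod_vars c \<union> mod_vars d"
| "mod_vars (While b c) = mod_vars c"
| "mod_vars _ = {}"

fun mod_arrs :: "com \<Rightarrow> name set" where
  "mod_arrs (Store a i e) = {a}"
| "mod_arrs (Seq c d) = mod_arrs c \<union> mod_arrs d"
| "mod_arrs (Cond b c d) = mod_arrs c \<union> mod_arrs d"
| "mod_arrs (While b c) = mod_arrs c"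
| "mod_arrs _ = {}"

text \<open>Frames spare the invariants everything that a command cannot modify, judged by its
  syntax alone.\<close>

definition frame :: "com \<Rightarrow> state \<Rightarrow> state \<Rightarrow> bool" where
  "frame c s s' \<longleftrightarrow>
     (\<forall>x. x \<notin> mod_vars c \<longrightarrow> var s' x = var s x) \<and> (\<forall>a. a \<notin> mod_arrs c \<longrightarrow> arr s' a = arr s a)"

lemma frame_var: "frame c s s' \<Longrightarrow> x \<notin> mod_vars c \<Longrightarrow> var s' x = var s x"
  and frame_arr: "frame c s s' \<Longrightarrow> a \<notin> mod_arrs c \<Longrightarrow> arr s' a = arr s a"
  by (auto simp: frame_def)

text \<open>The remaining command modifies no more names than the original one, so frames compose
  along a chain.\<close>

lemma step_frame:
  "(c', s') \<in> set_pmf (step c s) \<Longrightarrow>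
     mod_vars c' \<subseteq> mod_vars c \<and> mod_arrs c' \<subseteq> mod_arrs c \<and> frame c s s'"
proof (induction c arbitrary: c' s')
  case (Seq c d)
  show ?case
  proof (cases "c = SKIP")
    case True
    then show ?thesis using Seq.prems by (auto simp: frame_def)
  next
    case False
    then obtain c'' where "(c'', s') \<in> set_pmf (step c s)" "c' = Seq c'' d" using Seq.prems by auto
    then show ?thesis using Seq.IH(1)[of c'' s'] by (auto simp: frame_def)
  qed
qed (auto simp: frame_def set_var_def set_arr_def split: if_splits)

lemma chain_frame: "chain t (c, s) (c', s') \<Longrightarrow> frame c s s'"
proof (induction t arbitrary: c s)
  case (Suc t)
  then obtain a where a: "step c s = return_pmf a" "chain t a (c', s')" by auto
  have "mod_vars (fst a) \<subseteq> mod_vars c \<and> mod_arrs (fst a) \<subseteq> mod_arrs c \<and> frame c s (snd a)"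
    by (rule step_frame) (simp add: a)
  then show ?case using Suc.IH[of "fst a" "snd a"] a by (auto simp: frame_def subset_iff)
qed (auto simp: frame_def)

lemma reach_frame: "reach c s T Q \<Longrightarrow> reach c s T (\<lambda>s'. Q s' \<and> frame c s s')"
  unfolding reach_def using chain_frame by blast

text \<open>\<open>f\<close> is a ranking function. An iteration costs the body plus one step for
  the guard and one for leaving the sequence; the final 1 is the failing guard. The frame relative
  to the start of the loop comes for free.\<close>

lemma reach_While:
  assumes inv: "I s"
    and body: "\<And>s'. I s' \<Longrightarrow> frame c s s' \<Longrightarrow> bval b s' \<Longrightarrow> reach c s' T (\<lambda>s''. I s'' \<and> f s'' < f s')"
    and exit: "\<And>s'. I s' \<Longrightarrow> frame c s s' \<Longrightarrow> \<not> bval b s' \<Longrightarrow> Q s'"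
    and bound: "f s \<le> F"
  shows "reach (While b c) s (F * (T + 2) + 1) Q"
proof -
  have "reach (While b c) s' (f s' * (T + 2) + 1) Q" if "I s'" "frame c s s'" for s'
    using that
  proof (induction "f s'" arbitrary: s' rule: less_induct)
    case less
    show ?case
    proof (cases "bval b s'")
      case False
      then have "reach SKIP s' (f s' * (T + 2)) Q" using exit less by (intro reach_SKIP) auto
      then show ?thesis using False by (intro reach_step) auto
    next
      case True
      have "reach c s' T (\<lambda>s''. reach (While b c) s'' (f s' * (T + 2) - (T + 2) + 1) Q)"
      proof (rule reach_mono[OF reach_frame[OF body[OF less.prems True]]])
        fix s'' assume *: "(I s'' \<and> f s'' < f s') \<and> frame c s' s''"
        then have "frame c s s''" using less.prems by (auto simp: frame_def)
        with * have "reach (While b c) s'' (f s'' * (T + 2) + 1) Q"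
          using less.hyps by blast
        moreover have "(f s'' + 1) * (T + 2) \<le> f s' * (T + 2)" using * by (intro mult_right_mono) auto
        ultimately show "reach (While b c) s'' (f s' * (T + 2) - (T + 2) + 1) Q"
          by (elim reach_mono) (auto simp: algebra_simps)
      qed simp
      then have "reach (Seq c (While b c)) s' (T + (f s' * (T + 2) - (T + 2) + 1) + 1) Q"
        by (rule reach_Seq)
      \<comment> \<open>The body strictly decreases \<open>f\<close>, so \<open>f s'\<close> is
        positive and the subtraction of \<open>T + 2\<close> is not truncated.\<close>
      moreover have "0 < f s'" using body[OF less.prems True] by (auto simp: reach_def)
      then have "T + (f s' * (T + 2) - (T + 2) + 1) + 1 \<le> f s' * (T + 2)"
        by (cases "f s'") auto
      ultimately have "reach (Seq c (While b c)) s' (f s' * (T + 2)) Q" by (rule reach_mono)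
      then show ?thesis using True by (intro reach_step) auto
    qed
  qed
  from this[OF inv] have "reach (While b c) s (f s * (T + 2) + 1) Q" by (simp add: frame_def)
  then show ?thesis by (rule reach_mono) (use mult_right_mono[OF bound, of "T + 2"] in auto)
qed

definition For :: "name \<Rightarrow> name \<Rightarrow> com \<Rightarrow> com" where
  "For x y c = Seq (Assign x (Const 0))
     (While (Less (Var x) (Var y)) (Seq c (Assign x (Plus (Var x) (Const 1)))))"

lemma mod_vars_For [simp]: "mod_vars (For x y c) = insert x (mod_vars c)"
  and mod_arrs_For [simp]: "mod_arrs (For x y c) = mod_arrs c"
  by (auto simp: For_def)

lemma var_set_var [simp]: "var (set_var x k s) y = (if y = x then k else var s y)"
  and arr_set_var [simp]: "arr (set_var x k s) = arr s"
  and var_set_arr [simp]: "var (set_arr a i k s) = var s"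
  and arr_set_arr [simp]: "arr (set_arr a i k s) b = (if b = a then (arr s a)(i := k) else arr s b)"
  by (auto simp: set_var_def set_arr_def)

text \<open>The invariant takes the count \<open>k\<close> as an argument and ignores the counter
  variable, so the increment preserves it. A round adds guard, increment and two sequence steps to
  the body; the final 3 covers initialization, its sequence step and the failing guard.\<close>

lemma reach_For:
  assumes "x \<noteq> y" "x \<notin> mod_vars c" "y \<notin> mod_vars c"
    and bound: "var s y = N"
    and inv: "I 0 s"
    and indep: "\<And>k j s'. I k s' \<Longrightarrow> I k (set_var x j s')"
    and body: "\<And>k s'. k < N \<Longrightarrow> I k s' \<Longrightarrow> var s' x = k \<Longrightarrow> frame (For x y c) s s' \<Longrightarrow>
      reach c s' T (I (Suc k))"
    and exit: "\<And>s'. I N s' \<Longrightarrow> Q s'"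
  shows "reach (For x y c) s (N * (T + 4) + 3) Q"
proof -
  let ?b = "Seq c (Assign x (Plus (Var x) (Const 1)))"
  let ?s = "set_var x 0 s"
  have fr: "frame (For x y c) s s'" if "frame ?b ?s s'" for s'
    using that by (auto simp: frame_def)
  have y: "var s' y = N" if "frame ?b ?s s'" for s'
    using that assms by (auto simp: frame_def)
  have "reach (While (Less (Var x) (Var y)) ?b) ?s (N * ((T + 1 + 1) + 2) + 1) Q"
  proof (rule reach_While[where I = "\<lambda>s. I (var s x) s \<and> var s x \<le> N" and f = "\<lambda>s. N - var s x"])
    fix s' assume *: "I (var s' x) s' \<and> var s' x \<le> N" "frame ?b ?s s'" "bval (Less (Var x) (Var y)) s'"
    then have less: "var s' x < N" using y by simp
    have "reach c s' T (I (Suc (var s' x)))"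
      using body[OF less] * fr by simp
    then have "reach c s' T (\<lambda>s''. reach (Assign x (Plus (Var x) (Const 1))) s'' 1
      (\<lambda>s''. (I (var s'' x) s'' \<and> var s'' x \<le> N) \<and> N - var s'' x < N - var s' x))"
    proof (rule reach_mono[OF reach_frame])
      fix s'' assume **: "I (Suc (var s' x)) s'' \<and> frame c s' s''"
      then have "var s'' x = var s' x" using assms by (simp add: frame_def)
      then show "reach (Assign x (Plus (Var x) (Const 1))) s'' 1
      (\<lambda>s''. (I (var s'' x) s'' \<and> var s'' x \<le> N) \<and> N - var s'' x < N - var s' x)"
        using ** less indep by (intro reach_Assign) auto
    qed simp
    then show "reach ?b s' (T + 1 + 1)
      (\<lambda>s''. (I (var s'' x) s'' \<and> var s'' x \<le> N) \<and> N - var s'' x < N - var s' x)"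
      by (rule reach_Seq)
  next
    fix s' assume "I (var s' x) s' \<and> var s' x \<le> N" "frame ?b ?s s'" "\<not> bval (Less (Var x) (Var y)) s'"
    then show "Q s'" using y[of s'] exit[of s'] by auto
  qed (use inv indep in auto)
  then have "reach (Assign x (Const 0)) s 1
      (\<lambda>s'. reach (While (Less (Var x) (Var y)) ?b) s' (N * ((T + 1 + 1) + 2) + 1) Q)"
    by (intro reach_Assign) auto
  then have "reach (For x y c) s (1 + (N * ((T + 1 + 1) + 2) + 1) + 1) Q"
    unfolding For_def by (rule reach_Seq)
  then show ?thesis by (rule reach_mono) (auto simp: algebra_simps)
qed


section \<open>The algorithm\<close>

context edge_list
begin

lemma load_push:
  assumes "i < m" "0 < x i"
  shows "load (x(i := x i - 1)) (y(i := y i + 1)) =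
    (load x y)(u i := load x y (u i) - 1, v i := load x y (v i) + 1)"
proof
  fix w
  have *: "load x' y' w = ((if u i = w then x' i else 0) + (if v i = w then y' i else 0)) +
      (\<Sum>j\<in>{..<m} - {i}. (if u j = w then x' j else 0) + (if v j = w then y' j else 0))" for x' y'
    unfolding load_def using assms by (intro sum.remove) auto
  have "(\<Sum>j\<in>{..<m} - {i}. (if u j = w then (x(i := x i - 1)) j else 0) + (if v j = w then (y(i := y i + 1)) j else 0))
    = (\<Sum>j\<in>{..<m} - {i}. (if u j = w then x j else 0) + (if v j = w then y j else 0))"
    by (intro sum.cong) auto
  then show "load (x(i := x i - 1)) (y(i := y i + 1)) w =
    ((load x y)(u i := load x y (u i) - 1, v i := load x y (v i) + 1)) w"
    using assms u_neq_v[OF assms(1)] *[of x y] *[of "x(i := x i - 1)" "y(i := y i + 1)"] by auto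
qed

text \<open>Exchanging the endpoints is a symmetry of the locale; it reduces a move from
  \<open>v i\<close> to \<open>u i\<close> to \<open>load_push\<close>.\<close>

lemma load_swap: "load x y = edge_list.load m v u y x"
proof -
  interpret swap: edge_list n m v u using u_less v_less u_neq_v by unfold_locales metis+
  show ?thesis by (simp add: fun_eq_iff load_def swap.load_def add.commute)
qed

lemma load_push':
  assumes "i < m" "0 < y i"
  shows "load (x(i := x i + 1)) (y(i := y i - 1)) =
    (load x y)(v i := load x y (v i) - 1, u i := load x y (u i) + 1)"
proof -
  interpret swap: edge_list n m v u using u_less v_less u_neq_v by unfold_locales metis+
  show ?thesis unfolding load_swap using swap.load_push[of i y x] assms by simp
qed

end

text \<open>The potential of the local search: if \<open>l a = l b + 2 + k\<close>, it drops by
  \<open>2 * k + 2\<close>. At a difference of 1 the move would merely exchange the two loads, hence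
  the threshold in \<open>stable\<close>.\<close>

lemma sum_squares_push_less:
  fixes l :: "nat \<Rightarrow> nat"
  assumes "a < n" "b < n" "l b + 1 < l a"
  shows "(\<Sum>w<n. ((l(a := l a - 1, b := l b + 1)) w)\<^sup>2) < (\<Sum>w<n. (l w)\<^sup>2)"
proof -
  have ab: "a \<noteq> b" using assms by auto
  have *: "(\<Sum>w<n. (f w)\<^sup>2) = (f a)\<^sup>2 + ((f b)\<^sup>2 + (\<Sum>w\<in>{..<n} - {a} - {b}. (f w)\<^sup>2))" for f :: "nat \<Rightarrow> nat"
    using assms ab by (subst sum.remove[of _ a]; simp; subst sum.remove[of _ b]; simp)
  obtain k where k: "l a = l b + 2 + k" using assms(3) by (metis Suc_1 Suc_leI add_Suc_right le_Suc_ex One_nat_def add_0_right)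
  have "(\<Sum>w\<in>{..<n} - {a} - {b}. ((l(a := l a - 1, b := l b + 1)) w)\<^sup>2) = (\<Sum>w\<in>{..<n} - {a} - {b}. (l w)\<^sup>2)"
    by (intro sum.cong) auto
  moreover have "(l a - 1)\<^sup>2 + (l b + 1)\<^sup>2 < (l a)\<^sup>2 + (l b)\<^sup>2"
    unfolding k by (simp add: power2_eq_square algebra_simps)
  ultimately show ?thesis using ab unfolding *[of l] *[of "l(a := l a - 1, b := l b + 1)"] by simp
qed

text \<open>The total load is \<open>m * K\<close>, so this bounds the initial potential.\<close>

lemma sum_squares_le_square_sum:
  fixes l :: "nat \<Rightarrow> nat"
  shows "(\<Sum>w<n. (l w)\<^sup>2) \<le> (\<Sum>w<n. l w)\<^sup>2"
proof (induction n)
  case (Suc n)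
  then show ?case by (simp add: power2_sum)
qed simp

section \<open>Greedy placement from the last position\<close>

context edge_list
begin

text \<open>Positions are assigned from \<open>n\<close> downwards; the value 0 marks an unplaced vertex, so that
  \<open>\<pi> w' \<le> \<pi> w\<close> covers the vertices still to be placed before \<open>w\<close>.\<close>

definition partial_greedy :: "(nat \<Rightarrow> nat) \<Rightarrow> (nat \<Rightarrow> nat) \<Rightarrow> nat \<Rightarrow> bool" where
  "partial_greedy h \<pi> r \<longleftrightarrow> bij_betw \<pi> {w. w < n \<and> 0 < \<pi> w} {Suc r..n} \<and>
     (\<forall>w<n. \<forall>w'<n. 0 < \<pi> w \<longrightarrow> \<pi> w' \<le> \<pi> w \<longrightarrow>
        h w \<le> h w' \<and> (h w = h w' \<longrightarrow> degree_upto \<pi> (\<pi> w) w \<le> degree_upto \<pi> (\<pi> w) w'))"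

lemma partial_greedy_unplaced:
  assumes "partial_greedy h \<pi> (Suc r)" "Suc r \<le> n"
  shows "\<exists>w<n. \<pi> w = 0"
proof (rule ccontr)
  assume "\<not> ?thesis"
  then have "{w. w < n \<and> 0 < \<pi> w} = {..<n}" by auto
  then have "n = card {Suc (Suc r)..n}"
    using assms(1) bij_betw_same_card unfolding partial_greedy_def by fastforce
  then show False using assms by simp
qed

lemma partial_greedy_step:
  assumes pg: "partial_greedy h \<pi> (Suc r)" and r: "Suc r \<le> n" and b: "b < n" "\<pi> b = 0"
    and best: "\<And>w. w < n \<Longrightarrow> \<pi> w = 0 \<Longrightarrow> h b < h w \<or> (h b = h w \<and> degree_upto \<pi> 0 b \<le> degree_upto \<pi> 0 w)"
  shows "partial_greedy h (\<pi>(b := Suc r)) r"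
proof -
  let ?\<pi> = "\<pi>(b := Suc r)"
  have bij: "bij_betw \<pi> {w. w < n \<and> 0 < \<pi> w} {Suc (Suc r)..n}" using pg by (simp add: partial_greedy_def)
  have placed: "Suc (Suc r) \<le> \<pi> w" if "w < n" "\<pi> w \<noteq> 0" for w
    using bij_betwE[OF bij] that by auto
  \<comment> \<open>Both the old value 0 and the new value \<open>Suc r\<close> of \<open>b\<close>
    are within \<open>p\<close>, so the inequalities of the placed vertices persist.\<close>
  have old: "degree_upto ?\<pi> p w = degree_upto \<pi> p w" if "Suc r \<le> p" for p w
    using that b by (auto simp: degree_upto_def intro!: arg_cong[where f = card])
  \<comment> \<open>No vertex has a value from 1 to \<open>Suc r\<close> yet, so the degrees
    relevant at the new position are those among the unplaced vertices.\<close>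
  have new: "degree_upto \<pi> (Suc r) w = degree_upto \<pi> 0 w" for w
  proof -
    have "\<pi> z \<le> Suc r \<longleftrightarrow> \<pi> z \<le> 0" if "z < n" for z using placed[OF that] by fastforce
    then show ?thesis unfolding degree_upto_def
      by (intro arg_cong[where f = card] Collect_cong) (auto simp: u_less v_less)
  qed
  have "bij_betw ?\<pi> {w. w < n \<and> 0 < ?\<pi> w} {Suc r..n}"
  proof -
    have "bij_betw ?\<pi> {w. w < n \<and> 0 < \<pi> w} {Suc (Suc r)..n}"
      using bij by (rule bij_betw_cong[THEN iffD1, rotated]) (use b in auto)
    then have "bij_betw ?\<pi> ({w. w < n \<and> 0 < \<pi> w} \<union> {b}) ({Suc (Suc r)..n} \<union> {?\<pi> b})"
      by (rule notIn_Un_bij_betw[rotated 2]) (use b in auto)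
    moreover have "{w. w < n \<and> 0 < \<pi> w} \<union> {b} = {w. w < n \<and> 0 < ?\<pi> w}" using b by auto
    moreover have "{Suc (Suc r)..n} \<union> {?\<pi> b} = {Suc r..n}" using r by auto
    ultimately show ?thesis by simp
  qed
  moreover have "h w \<le> h w' \<and> (h w = h w' \<longrightarrow> degree_upto ?\<pi> (?\<pi> w) w \<le> degree_upto ?\<pi> (?\<pi> w) w')"
    if w: "w < n" "w' < n" "0 < ?\<pi> w" "?\<pi> w' \<le> ?\<pi> w" for w w'
  proof (cases "w = b")
    case True
    then have "w' = b \<or> \<pi> w' = 0" using w placed[of w'] by (cases "w' = b") auto
    then have "h b < h w' \<or> (h b = h w' \<and> degree_upto \<pi> 0 b \<le> degree_upto \<pi> 0 w')"
      using best[of w'] w b by auto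
    then show ?thesis using True old[of "Suc r"] new by auto
  next
    case False
    then have "Suc (Suc r) \<le> \<pi> w" using w placed[of w] by simp
    moreover have "\<pi> w' \<le> \<pi> w" using w False b by (auto split: if_splits)
    ultimately show ?thesis
      using pg w False old[of "\<pi> w"] unfolding partial_greedy_def by auto
  qed
  ultimately show ?thesis unfolding partial_greedy_def by blast
qed

text \<open>For an unplaced \<open>w\<close>, placing \<open>b\<close> deletes just the edges
  between \<open>b\<close> and \<open>w\<close>. These were counted before, so the subtraction is
  not truncated.\<close>

lemma degree_upto_0_step:
  assumes "b < n" "\<pi> b = 0" "\<pi> w = 0" "w \<noteq> b"
  shows "degree_upto (\<pi>(b := Suc r)) 0 w =
    degree_upto \<pi> 0 w - card {i. i < m \<and> (u i = b \<and> v i = w \<or> v i = b \<and> u i = w)}"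
proof -
  let ?X = "{i. i < m \<and> (u i = w \<or> v i = w) \<and> \<pi> (u i) \<le> 0 \<and> \<pi> (v i) \<le> 0}"
  let ?Y = "{i. i < m \<and> (u i = b \<and> v i = w \<or> v i = b \<and> u i = w)}"
  have "{i. i < m \<and> (u i = w \<or> v i = w) \<and> (\<pi>(b := Suc r)) (u i) \<le> 0 \<and> (\<pi>(b := Suc r)) (v i) \<le> 0} = ?X - ?Y"
    using assms by (auto split: if_splits)
  moreover have "card (?X - ?Y) = card ?X - card ?Y"
    using assms by (intro card_Diff_subset) auto
  ultimately show ?thesis by (simp add: degree_upto_def)
qed

lemma partial_greedy_final:
  assumes "partial_greedy h \<pi> 0"
  shows "bij_betw \<pi> {..<n} {1..n}" "greedy_order h \<pi>"
proof -
  let ?P = "{w. w < n \<and> 0 < \<pi> w}"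
  have bij: "bij_betw \<pi> ?P {1..n}" using assms by (simp add: partial_greedy_def)
  then have "card ?P = n" using bij_betw_same_card by fastforce
  then have P: "?P = {..<n}" by (intro card_subset_eq) auto
  with bij show "bij_betw \<pi> {..<n} {1..n}" by simp
  have "0 < \<pi> w" if "w < n" for w using P that by auto
  then show "greedy_order h \<pi>" using assms by (auto simp: partial_greedy_def greedy_order_def)
qed

lemma partial_greedy_initial: "partial_greedy h (\<lambda>_. 0) n"
  by (simp add: partial_greedy_def bij_betw_def)

end

section \<open>The program\<close>

definition Eq :: "aexp \<Rightarrow> aexp \<Rightarrow> bexp" where
  "Eq e f = Conj (Neg (Less e f)) (Neg (Less f e))"

lemma bval_Eq [simp]: "bval (Eq e f) s \<longleftrightarrow> aval e s = aval f s"
  by (auto simp: Eq_def)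

definition incr :: "name \<Rightarrow> aexp \<Rightarrow> com" where
  "incr x e = Assign x (Plus (Var x) e)"

definition add_at :: "name \<Rightarrow> aexp \<Rightarrow> aexp \<Rightarrow> com" where
  "add_at a i e = Store a i (Plus (Read a i) e)"

definition sub_at :: "name \<Rightarrow> aexp \<Rightarrow> aexp \<Rightarrow> com" where
  "sub_at a i e = Store a i (Minus (Read a i) e)"

lemmas command_defs = incr_def add_at_def sub_at_def

abbreviation src :: aexp where "src \<equiv> Read ''u'' (Var ''i'')"
abbreviation tgt :: aexp where "tgt \<equiv> Read ''v'' (Var ''i'')"

text \<open>In the absence of multiplication, \<open>K = 2n(n + 1)(n + 2) + 1\<close> is tabulated by finite differences.\<close>

definition compute_multiplicity :: com where
  "compute_multiplicity = Seq
     (For ''i'' ''n''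
       (Seq (incr ''a'' (Const 12)) (Seq (incr ''b'' (Var ''a'')) (incr ''K'' (Var ''b'')))))
     (incr ''K'' (Const 1))"

text \<open>All copies of an edge start at its first endpoint, so \<open>y\<close> keeps its initial
  zeros. The degrees collected in \<open>d\<close> serve the placement phase.\<close>

definition init_loads :: com where
  "init_loads = For ''i'' ''m''
     (Seq (Store ''x'' (Var ''i'') (Var ''K''))
     (Seq (add_at ''l'' src (Var ''K''))
     (Seq (add_at ''d'' src (Const 1)) (add_at ''d'' tgt (Const 1)))))"

text \<open>A move may destabilize edges already checked, so the scan restarts at 0; once it reaches
  \<open>m\<close>, all edges are stable simultaneously.\<close>

definition balance_body :: com where
  "balance_body =
     Cond (Conj (Less (Plus (Read ''l'' tgt) (Const 1)) (Read ''l'' src)) (Less (Const 0) (Read ''x'' (Var ''i''))))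
       (Seq (sub_at ''x'' (Var ''i'') (Const 1)) (Seq (add_at ''y'' (Var ''i'') (Const 1))
       (Seq (sub_at ''l'' src (Const 1)) (Seq (add_at ''l'' tgt (Const 1)) (Assign ''i'' (Const 0))))))
    (Cond (Conj (Less (Plus (Read ''l'' src) (Const 1)) (Read ''l'' tgt)) (Less (Const 0) (Read ''y'' (Var ''i''))))
       (Seq (sub_at ''y'' (Var ''i'') (Const 1)) (Seq (add_at ''x'' (Var ''i'') (Const 1))
       (Seq (sub_at ''l'' tgt (Const 1)) (Seq (add_at ''l'' src (Const 1)) (Assign ''i'' (Const 0))))))
       (incr ''i'' (Const 1)))"

definition balance :: com where
  "balance = Seq (Assign ''i'' (Const 0)) (While (Less (Var ''i'') (Var ''m'')) balance_body)"

text \<open>A vertex of load \<open>t + 1\<close> advances \<open>t\<close> and restarts the scan; a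
  scan that finds none shows that \<open>t + 1\<close> is missing.\<close>

definition raise_body :: com where
  "raise_body = Cond (Eq (Read ''l'' (Var ''i'')) (Plus (Var ''t'') (Const 1)))
     (Seq (incr ''t'' (Const 1)) (Assign ''i'' (Const 0))) (incr ''i'' (Const 1))"

definition compute_level :: com where
  "compute_level =
     Seq (Seq (Assign ''t'' (Read ''l'' (Var ''w''))) (Assign ''i'' (Const 0)))
     (Seq (While (Less (Var ''i'') (Var ''n'')) raise_body)
          (Store ''h'' (Var ''w'') (Var ''t'')))"

definition compute_levels :: com where
  "compute_levels = For ''w'' ''n'' compute_level"

text \<open>\<open>b = n\<close> encodes that no unplaced vertex has been seen yet.\<close>

definition select_vertex :: com where
  "select_vertex = For ''w'' ''n''
     (Cond (Conj (Less (Read ''pi'' (Var ''w'')) (Const 1))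
        (Neg (Conj (Less (Var ''b'') (Var ''n''))
          (Conj (Neg (Less (Read ''h'' (Var ''w'')) (Read ''h'' (Var ''b''))))
            (Neg (Conj (Eq (Read ''h'' (Var ''w'')) (Read ''h'' (Var ''b'')))
              (Less (Read ''d'' (Var ''w'')) (Read ''d'' (Var ''b'')))))))))
       (Assign ''b'' (Var ''w'')) SKIP)"

text \<open>Entries of \<open>d\<close> at placed vertices are meaningless from here on.\<close>

definition update_degrees :: com where
  "update_degrees = For ''i'' ''m''
     (Cond (Eq src (Var ''b'')) (sub_at ''d'' tgt (Const 1))
       (Cond (Eq tgt (Var ''b'')) (sub_at ''d'' src (Const 1)) SKIP))"

definition place_vertex :: com where
  "place_vertex =
     Seq (Assign ''b'' (Var ''n''))
     (Seq select_vertex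
     (Seq (Store ''pi'' (Var ''b'') (Minus (Var ''n'') (Var ''r''))) update_degrees))"

definition place_vertices :: com where
  "place_vertices = For ''r'' ''n'' place_vertex"

definition mlvc_algorithm :: com where
  "mlvc_algorithm = Seq compute_multiplicity (Seq init_loads (Seq balance
     (Seq compute_levels place_vertices)))"

lemmas program_defs = command_defs compute_multiplicity_def init_loads_def balance_body_def
  balance_def raise_body_def compute_level_def compute_levels_def select_vertex_def
  update_degrees_def place_vertex_def place_vertices_def

section \<open>Correctness and running time of the phases\<close>

context edge_list
begin

definition input :: "state \<Rightarrow> bool" where
  "input s \<longleftrightarrow> var s ''n'' = n \<and> var s ''m'' = m \<and> arr s ''u'' = u \<and> arr s ''v'' = v"

lemma input_frame:
  "input s \<Longrightarrow> frame c s s' \<Longrightarrow> ''n'' \<notin> mod_vars c \<Longrightarrow> ''m'' \<notin> mod_vars c \<Longrightarrow>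
     ''u'' \<notin> mod_arrs c \<Longrightarrow> ''v'' \<notin> mod_arrs c \<Longrightarrow> input s'"
  by (simp add: input_def frame_def)

lemma compute_multiplicity_correct:
  assumes "input s" "var s ''a'' = 0" "var s ''b'' = 0" "var s ''K'' = 0"
  shows "reach compute_multiplicity s (n * 9 + 5) (\<lambda>s'. var s' ''K'' = 2 * n * (n + 1) * (n + 2) + 1)"
proof -
  let ?c = "Seq (incr ''a'' (Const 12)) (Seq (incr ''b'' (Var ''a'')) (incr ''K'' (Var ''b'')))"
  \<comment> \<open>\<open>a\<close> and \<open>b\<close> hold the second and first backward
    differences of the cubic \<open>2 * k * (k + 1) * (k + 2)\<close>, whose third difference is
    12.\<close>
  let ?I = "\<lambda>k (s' :: state). var s' ''a'' = 12 * k \<and> var s' ''b'' = 6 * k * (k + 1) \<and> var s' ''K'' = 2 * k * (k + 1) * (k + 2)"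
  have "reach (For ''i'' ''n'' ?c) s (n * (duration ?c + 4) + 3)
    (\<lambda>s'. reach (incr ''K'' (Const 1)) s' 1 (\<lambda>s'. var s' ''K'' = 2 * n * (n + 1) * (n + 2) + 1))"
  proof (rule reach_For[where I = ?I])
    fix k s' assume "?I k s'"
    then show "reach ?c s' (duration ?c) (?I (Suc k))"
      by (intro reach_straight) (simp_all add: command_defs algebra_simps)
  next
    fix s' assume "?I n s'"
    then show "reach (incr ''K'' (Const 1)) s' 1 (\<lambda>s'. var s' ''K'' = 2 * n * (n + 1) * (n + 2) + 1)"
      unfolding incr_def by (intro reach_Assign) simp
  qed (use assms in \<open>auto simp: input_def command_defs\<close>)
  from reach_Seq[OF this] show ?thesis
    unfolding compute_multiplicity_def by (rule reach_mono) (simp_all add: command_defs)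
qed

lemma init_loads_correct:
  assumes "input s" "arr s ''l'' = (\<lambda>_. 0)" "arr s ''d'' = (\<lambda>_. 0)" "arr s ''y'' = (\<lambda>_. 0)"
  shows "reach init_loads s (m * 11 + 3) (\<lambda>s'.
     (\<forall>i<m. arr s' ''x'' i = var s ''K'') \<and> arr s' ''l'' = load (arr s' ''x'') (arr s ''y'') \<and>
     arr s' ''d'' = degree_upto (\<lambda>_. 0) 0)"
proof -
  let ?c = "Seq (Store ''x'' (Var ''i'') (Var ''K''))
     (Seq (add_at ''l'' src (Var ''K''))
     (Seq (add_at ''d'' src (Const 1)) (add_at ''d'' tgt (Const 1))))"
  let ?K = "var s ''K''"
  let ?I = "\<lambda>k (s' :: state). (\<forall>i<k. arr s' ''x'' i = ?K) \<and>
    arr s' ''l'' = (\<lambda>w. \<Sum>i<k. if u i = w then ?K else 0) \<and>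
    arr s' ''d'' = (\<lambda>w. \<Sum>i<k. of_bool (u i = w \<or> v i = w))"
  have "reach (For ''i'' ''m'' ?c) s (m * (duration ?c + 4) + 3) (\<lambda>s'.
     (\<forall>i<m. arr s' ''x'' i = var s ''K'') \<and> arr s' ''l'' = load (arr s' ''x'') (arr s ''y'') \<and>
     arr s' ''d'' = degree_upto (\<lambda>_. 0) 0)"
  proof (rule reach_For[where I = ?I])
    fix k s' assume k: "k < m" "?I k s'" "var s' ''i'' = k" and fr: "frame (For ''i'' ''m'' ?c) s s'"
    have "input s'" by (rule input_frame[OF assms(1) fr]) (simp_all add: command_defs)
    moreover have "var s' ''K'' = ?K" using frame_var[OF fr, of "''K''"] by (simp add: command_defs)
    ultimately show "reach ?c s' (duration ?c) (?I (Suc k))"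
      using k u_neq_v[OF k(1)]
      by (intro reach_straight) (auto simp: command_defs input_def less_Suc_eq fun_eq_iff)
  next
    fix s' assume I: "?I m s'"
    have "(\<Sum>i<m. if u i = w then ?K else 0) = load (arr s' ''x'') (arr s ''y'') w" for w
      unfolding load_def using I assms by (intro sum.cong) auto
    then show "(\<forall>i<m. arr s' ''x'' i = var s ''K'') \<and> arr s' ''l'' = load (arr s' ''x'') (arr s ''y'') \<and>
     arr s' ''d'' = degree_upto (\<lambda>_. 0) 0"
      using I by (auto simp: fun_eq_iff degree_upto_eq_sum)
  qed (use assms in \<open>auto simp: input_def command_defs\<close>)
  then show ?thesis unfolding init_loads_def by (rule reach_mono) (simp_all add: command_defs)
qed

end

text \<open>The nesting mirrors \<open>mlvc_algorithm\<close>: one summand per phase and one extra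
  step per sequence.\<close>

definition step_bound :: "nat \<Rightarrow> nat \<Rightarrow> nat \<Rightarrow> nat" where
  "step_bound n m K = (n * 9 + 5) + ((m * 11 + 3) + ((((m * K)\<^sup>2 * (m + 1) + m) * 23 + 3) +
     ((n * ((n * (n + 1) + n) * 7 + 11) + 3) + (n * (n * 7 + m * 9 + 15) + 3) + 1) + 1) + 1) + 1"

context edge_list
begin

lemma balance_correct:
  assumes inp: "input s" and split: "\<forall>i<m. arr s ''x'' i + arr s ''y'' i = K"
    and load: "arr s ''l'' = load (arr s ''x'') (arr s ''y'')"
  shows "reach balance s (((m * K)\<^sup>2 * (m + 1) + m) * 23 + 3) (\<lambda>s'.
    (\<forall>i<m. arr s' ''x'' i + arr s' ''y'' i = K) \<and>
    arr s' ''l'' = load (arr s' ''x'') (arr s' ''y'') \<and>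
    (\<forall>i<m. stable (arr s' ''l'') (arr s' ''x'') (arr s' ''y'') i))" (is "reach _ _ _ ?Q")
proof -
  define I :: "state \<Rightarrow> bool" where "I s' \<longleftrightarrow> (\<forall>i<m. arr s' ''x'' i + arr s' ''y'' i = K) \<and>
    arr s' ''l'' = load (arr s' ''x'') (arr s' ''y'') \<and>
    (\<forall>i<var s' ''i''. stable (arr s' ''l'') (arr s' ''x'') (arr s' ''y'') i) \<and> var s' ''i'' \<le> m" for s'
  \<comment> \<open>A lexicographic ranking, first by potential and then by the edges left to scan;
    the factor \<open>m + 1\<close> suffices as the second component is at most
    \<open>m\<close>.\<close>
  define f :: "state \<Rightarrow> nat" where
    "f s' = (\<Sum>w<n. (arr s' ''l'' w)\<^sup>2) * (m + 1) + (m - var s' ''i'')" for s'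
  let ?s = "set_var ''i'' 0 s"
  have "reach (While (Less (Var ''i'') (Var ''m'')) balance_body) ?s
      (((m * K)\<^sup>2 * (m + 1) + m) * (21 + 2) + 1) ?Q"
  proof (rule reach_While[where I = I and f = f])
    show "I ?s" using split load by (simp add: I_def)
    have "(\<Sum>w<n. (arr s ''l'' w)\<^sup>2) \<le> (m * K)\<^sup>2"
      using sum_squares_le_square_sum[of "arr s ''l''" n] sum_load[of "arr s ''x''" "arr s ''y''" K] split
      by (simp add: load)
    then have "(\<Sum>w<n. (arr s ''l'' w)\<^sup>2) * (m + 1) \<le> (m * K)\<^sup>2 * (m + 1)" by (rule mult_right_mono) simp
    then show "f ?s \<le> (m * K)\<^sup>2 * (m + 1) + m" by (simp add: f_def)
  next
    fix s' assume I: "I s'" and fr: "frame balance_body ?s s'" and b: "bval (Less (Var ''i'') (Var ''m'')) s'"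
    have "input ?s" using inp by (simp add: input_def)
    then have inp': "input s'" by (rule input_frame[OF _ fr]) (simp_all add: program_defs)
    define x y l i where "x = arr s' ''x''" and "y = arr s' ''y''" and "l = arr s' ''l''" and "i = var s' ''i''"
    note defs = x_def[symmetric] y_def[symmetric] l_def[symmetric] i_def[symmetric]
    have i: "i < m" using b inp' by (simp add: input_def i_def)
    note uv = u_neq_v[OF i] u_less[OF i] v_less[OF i]
    have l: "l = load x y" using I by (simp add: I_def defs)
    have xy: "\<And>j. j < m \<Longrightarrow> x j + y j = K" using I by (simp add: I_def defs)
    have st: "\<And>j. j < i \<Longrightarrow> stable l x y j"
      using I unfolding I_def x_def y_def l_def i_def by blast
    have uvs: "arr s' ''u'' = u" "arr s' ''v'' = v" using inp' by (simp_all add: input_def)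
    \<comment> \<open>A drop of the potential outweighs the reset of the scan to 0.\<close>
    have decr: "A * (m + 1) + m < B * (m + 1) + (m - i)" if "A < B" for A B
    proof -
      have "(A + 1) * (m + 1) \<le> B * (m + 1)" using that by (intro mult_right_mono) auto
      then show ?thesis by simp
    qed
    have "I (exec balance_body s') \<and> f (exec balance_body s') < f s'"
    proof (cases "l (v i) + 1 < l (u i) \<and> 0 < x i")
      case True
      let ?x = "x(i := x i - 1)" and ?y = "y(i := y i + 1)" and ?l = "l(u i := l (u i) - 1, v i := l (v i) + 1)"
      let ?e = "exec balance_body s'"
      have e: "arr ?e ''x'' = ?x" "arr ?e ''y'' = ?y" "arr ?e ''l'' = ?l" "var ?e ''i'' = 0"
        using True uv by (simp_all add: balance_body_def command_defs uvs defs)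
      have "?l = load ?x ?y" using load_push[of i x y] i True l by simp
      moreover have "?x j + ?y j = K" if "j < m" for j using xy[OF that] True by auto
      moreover have "(\<Sum>w<n. (?l w)\<^sup>2) < (\<Sum>w<n. (l w)\<^sup>2)"
        using uv True by (intro sum_squares_push_less) auto
      ultimately show ?thesis
        unfolding I_def f_def e using decr by (simp add: defs)
    next
      case F: False
      show ?thesis
      proof (cases "l (u i) + 1 < l (v i) \<and> 0 < y i")
        case True
        let ?x = "x(i := x i + 1)" and ?y = "y(i := y i - 1)" and ?l = "l(v i := l (v i) - 1, u i := l (u i) + 1)"
        let ?e = "exec balance_body s'"
        have e: "arr ?e ''x'' = ?x" "arr ?e ''y'' = ?y" "arr ?e ''l'' = ?l" "var ?e ''i'' = 0"
          using True F uv by (simp_all add: balance_body_def command_defs uvs defs)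
        have "?l = load ?x ?y" using load_push'[of i y x] i True l by simp
        moreover have "?x j + ?y j = K" if "j < m" for j using xy[OF that] True by auto
        moreover have "(\<Sum>w<n. (?l w)\<^sup>2) < (\<Sum>w<n. (l w)\<^sup>2)"
          using uv True by (intro sum_squares_push_less) auto
        ultimately show ?thesis
          unfolding I_def f_def e using decr by (simp add: defs)
      next
        case False
        have e: "exec balance_body s' = set_var ''i'' (i + 1) s'"
          using False F by (auto simp add: balance_body_def command_defs uvs defs)
        have "stable l x y i" using False F by (auto simp: stable_def)
        then show ?thesis
          unfolding e I_def f_def using xy l st i by (auto simp: defs less_Suc_eq)
      qed
    qed
    moreover have "duration balance_body = 21" by (simp add: balance_body_def command_defs)
    moreover have "straight balance_body" by (simp add: balance_body_def command_defs)
    ultimately show "reach balance_body s' 21 (\<lambda>s''. I s'' \<and> f s'' < f s')"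
      using reach_straight[of balance_body "\<lambda>s''. I s'' \<and> f s'' < f s'" s'] by simp
  next
    fix s' assume I: "I s'" and fr: "frame balance_body ?s s'" and b: "\<not> bval (Less (Var ''i'') (Var ''m'')) s'"
    have "input ?s" using inp by (simp add: input_def)
    then have "input s'" by (rule input_frame[OF _ fr]) (simp_all add: program_defs)
    then have "var s' ''i'' = m" using I b by (simp add: I_def input_def)
    with I show "?Q s'" unfolding I_def by blast
  qed
  then have "reach (Assign ''i'' (Const 0)) s 1 (\<lambda>s'. reach (While (Less (Var ''i'') (Var ''m'')) balance_body) s'
      (((m * K)\<^sup>2 * (m + 1) + m) * (21 + 2) + 1) ?Q)"
    by (intro reach_Assign) simp
  from reach_Seq[OF this] show ?thesis unfolding balance_def by (rule reach_mono) (simp, blast)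
qed

lemma compute_level_correct:
  assumes inp: "input s" and w: "var s ''w'' < n"
  shows "reach compute_level s ((n * (n + 1) + n) * 7 + 7) (\<lambda>s'. \<exists>t.
    gap_level (arr s ''l'') (var s ''w'') t \<and> arr s' ''h'' = (arr s ''h'')(var s ''w'' := t))"
    (is "reach _ _ _ ?Q")
proof -
  define l w where "l = arr s ''l''" and "w = var s ''w''"
  define I :: "state \<Rightarrow> bool" where "I s' \<longleftrightarrow> l w \<le> var s' ''t'' \<and> {l w<..var s' ''t''} \<subseteq> l ` {..<n} \<and>
    (\<forall>j<var s' ''i''. l j \<noteq> var s' ''t'' + 1) \<and> var s' ''i'' \<le> n" for s'
  \<comment> \<open>Again lexicographic: first the advances of \<open>t\<close>, which by
    \<open>run_of_loads_le\<close> cannot pass \<open>l w + n\<close>, then the scan.\<close>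
  define f :: "state \<Rightarrow> nat" where
    "f s' = (l w + n - var s' ''t'') * (n + 1) + (n - var s' ''i'')" for s'
  let ?s = "set_var ''i'' 0 (set_var ''t'' (l w) s)"
  have "reach (While (Less (Var ''i'') (Var ''n'')) raise_body) ?s ((n * (n + 1) + n) * (5 + 2) + 1)
    (\<lambda>s'. reach (Store ''h'' (Var ''w'') (Var ''t'')) s' 1 ?Q)"
  proof (rule reach_While[where I = I and f = f])
    show "I ?s" by (simp add: I_def)
    show "f ?s \<le> n * (n + 1) + n" by (simp add: f_def)
  next
    fix s' assume I: "I s'" and fr: "frame raise_body ?s s'" and b: "bval (Less (Var ''i'') (Var ''n'')) s'"
    have n: "var s' ''n'' = n" and l: "arr s' ''l'' = l"
      using fr inp by (simp_all add: frame_def raise_body_def command_defs input_def l_def)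
    have i: "var s' ''i'' < n" using b n by simp
    have "I (exec raise_body s') \<and> f (exec raise_body s') < f s'"
    proof (cases "l (var s' ''i'') = var s' ''t'' + 1")
      case True
      have e: "exec raise_body s' = set_var ''i'' 0 (set_var ''t'' (var s' ''t'' + 1) s')"
        using True l by (simp add: raise_body_def command_defs)
      have t: "var s' ''t'' + 1 \<in> l ` {..<n}" using True i by (metis imageI lessThan_iff)
      have "{l w<..var s' ''t'' + 1} \<subseteq> insert (var s' ''t'' + 1) {l w<..var s' ''t''}" by auto
      then have sub: "{l w<..var s' ''t'' + 1} \<subseteq> l ` {..<n}" using I t unfolding I_def by blast
      then have le: "var s' ''t'' + 1 \<le> l w + n" by (rule run_of_loads_le)
      have "I (exec raise_body s')" using I sub unfolding e by (simp add: I_def)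
      moreover have "(l w + n - (var s' ''t'' + 1) + 1) * (n + 1) \<le> (l w + n - var s' ''t'') * (n + 1)"
        using le by (intro mult_right_mono) auto
      then have "f (exec raise_body s') < f s'" unfolding e f_def by simp
      ultimately show ?thesis by simp
    next
      case False
      have e: "exec raise_body s' = set_var ''i'' (var s' ''i'' + 1) s'"
        using False l by (simp add: raise_body_def command_defs)
      show ?thesis unfolding e using I i False by (auto simp: I_def f_def less_Suc_eq)
    qed
    moreover have "duration raise_body = 5" "straight raise_body" by (simp_all add: raise_body_def command_defs)
    ultimately show "reach raise_body s' 5 (\<lambda>s''. I s'' \<and> f s'' < f s')"
      using reach_straight[of raise_body "\<lambda>s''. I s'' \<and> f s'' < f s'" s'] by simp
  next
    fix s' assume I: "I s'" and fr: "frame raise_body ?s s'" and b: "\<not> bval (Less (Var ''i'') (Var ''n'')) s'"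
    have "var s' ''n'' = n" and w': "var s' ''w'' = w" and h: "arr s' ''h'' = arr s ''h''"
      using fr inp by (simp_all add: frame_def raise_body_def command_defs input_def w_def)
    then have "var s' ''i'' = n" using I b by (simp add: I_def)
    then have "gap_level l w (var s' ''t'')" using I unfolding I_def gap_level_def by fastforce
    then show "reach (Store ''h'' (Var ''w'') (Var ''t'')) s' 1 ?Q"
      using w' h by (intro reach_Store) (auto simp: l_def w_def)
  qed
  note loop = reach_Seq[OF this]
  have "reach (Seq (Assign ''t'' (Read ''l'' (Var ''w''))) (Assign ''i'' (Const 0))) s
    (duration (Seq (Assign ''t'' (Read ''l'' (Var ''w''))) (Assign ''i'' (Const 0))))
    (\<lambda>s'. reach (Seq (While (Less (Var ''i'') (Var ''n'')) raise_body) (Store ''h'' (Var ''w'') (Var ''t''))) s'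
       ((n * (n + 1) + n) * (5 + 2) + 1 + 1 + 1) ?Q)"
    by (rule reach_straight) (use loop in \<open>simp_all add: l_def w_def\<close>)
  from reach_Seq[OF this] show ?thesis unfolding compute_level_def by (rule reach_mono) simp_all
qed

lemma compute_levels_correct:
  assumes inp: "input s"
  shows "reach compute_levels s (n * ((n * (n + 1) + n) * 7 + 11) + 3)
    (\<lambda>s'. \<forall>w<n. gap_level (arr s ''l'') w (arr s' ''h'' w))"
proof -
  let ?I = "\<lambda>k (s' :: state). \<forall>w<k. gap_level (arr s ''l'') w (arr s' ''h'' w)"
  have "reach (For ''w'' ''n'' compute_level) s (n * (((n * (n + 1) + n) * 7 + 7) + 4) + 3)
    (\<lambda>s'. \<forall>w<n. gap_level (arr s ''l'') w (arr s' ''h'' w))"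
  proof (rule reach_For[where I = ?I])
    fix k s' assume k: "k < n" "?I k s'" "var s' ''w'' = k" and fr: "frame (For ''w'' ''n'' compute_level) s s'"
    have inp': "input s'" by (rule input_frame[OF inp fr]) (simp_all add: program_defs)
    have l: "arr s' ''l'' = arr s ''l''" by (rule frame_arr[OF fr]) (simp add: program_defs)
    show "reach compute_level s' ((n * (n + 1) + n) * 7 + 7) (?I (Suc k))"
      by (rule reach_mono[OF compute_level_correct[OF inp']]) (use k l in \<open>auto simp: less_Suc_eq\<close>)
  qed (use inp in \<open>simp_all add: input_def program_defs\<close>)
  then show ?thesis unfolding compute_levels_def by (rule reach_mono) simp_all
qed

lemma select_vertex_correct:
  fixes s :: state
  defines "\<pi> \<equiv> arr s ''pi''" and "h \<equiv> arr s ''h''" and "d \<equiv> arr s ''d''"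
  assumes inp: "input s" and b: "var s ''b'' = n" and ex: "\<exists>w<n. \<pi> w = 0"
  shows "reach select_vertex s (n * 7 + 3) (\<lambda>s'. var s' ''b'' < n \<and> \<pi> (var s' ''b'') = 0 \<and>
    (\<forall>w<n. \<pi> w = 0 \<longrightarrow> h (var s' ''b'') < h w \<or> (h (var s' ''b'') = h w \<and> d (var s' ''b'') \<le> d w)))"
    (is "reach _ _ _ ?Q")
proof -
  let ?c = "(Cond (Conj (Less (Read ''pi'' (Var ''w'')) (Const 1))
        (Neg (Conj (Less (Var ''b'') (Var ''n''))
          (Conj (Neg (Less (Read ''h'' (Var ''w'')) (Read ''h'' (Var ''b''))))
            (Neg (Conj (Eq (Read ''h'' (Var ''w'')) (Read ''h'' (Var ''b'')))
              (Less (Read ''d'' (Var ''w'')) (Read ''d'' (Var ''b'')))))))))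
       (Assign ''b'' (Var ''w'')) SKIP)"
  \<comment> \<open>Either no unplaced vertex has been seen, or \<open>b\<close> is unplaced and no
    unplaced vertex seen so far is lexicographically smaller in \<open>h\<close> and
    \<open>d\<close>.\<close>
  define J where "J k b \<longleftrightarrow> (b = n \<and> (\<forall>w<k. \<pi> w \<noteq> 0)) \<or> (b < n \<and> \<pi> b = 0 \<and>
    (\<forall>w<k. \<pi> w = 0 \<longrightarrow> h b < h w \<or> (h b = h w \<and> d b \<le> d w)))" for k b
  let ?I = "\<lambda>k (s' :: state). J k (var s' ''b'')"
  have "reach (For ''w'' ''n'' ?c) s (n * (duration ?c + 4) + 3) ?Q"
  proof (rule reach_For[where I = ?I])
    fix k s' assume k: "k < n" "?I k s'" "var s' ''w'' = k" and fr: "frame (For ''w'' ''n'' ?c) s s'"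
    have "input s'" by (rule input_frame[OF inp fr]) simp_all
    then have n: "var s' ''n'' = n" by (simp add: input_def)
    have a: "arr s' ''pi'' = \<pi>" "arr s' ''h'' = h" "arr s' ''d'' = d"
      using fr by (simp_all add: frame_def \<pi>_def h_def d_def)
    have "?I (Suc k) (exec ?c s')"
      using k n a by (auto simp: J_def less_Suc_eq)
    then show "reach ?c s' (duration ?c) (?I (Suc k))"
      by (intro reach_straight) simp_all
  next
    fix s' assume "?I n s'"
    then show "?Q s'" using ex by (auto simp: J_def)
  qed (use inp b in \<open>simp_all add: input_def J_def\<close>)
  then show ?thesis unfolding select_vertex_def by (rule reach_mono) simp_all
qed

lemma update_degrees_correct:
  assumes inp: "input s" and b: "b = var s ''b''"
  shows "reach update_degrees s (m * 9 + 3) (\<lambda>s'. arr s' ''d'' =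
    (\<lambda>w. arr s ''d'' w - card {i. i < m \<and> (u i = b \<and> v i = w \<or> v i = b \<and> u i = w)}))"
    (is "reach _ _ _ ?Q")
proof -
  let ?c = "Cond (Eq src (Var ''b'')) (sub_at ''d'' tgt (Const 1))
       (Cond (Eq tgt (Var ''b'')) (sub_at ''d'' src (Const 1)) SKIP)"
  define D where "D k w = (\<Sum>i<k. of_bool (u i = b \<and> v i = w \<or> v i = b \<and> u i = w) :: nat)" for k w
  have D_Suc: "D (Suc k) w = D k w + of_bool (u k = b \<and> v k = w \<or> v k = b \<and> u k = w)" for k w
    by (simp add: D_def)
  \<comment> \<open>Successive truncated subtractions of 1 amount to one truncated subtraction of
    the count, so the invariant holds for every \<open>w\<close>, placed or not.\<close>
  let ?I = "\<lambda>k (s' :: state). arr s' ''d'' = (\<lambda>w. arr s ''d'' w - D k w)"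
  have "reach (For ''i'' ''m'' ?c) s (m * (duration ?c + 4) + 3) ?Q"
  proof (rule reach_For[where I = ?I])
    fix k s' assume k: "k < m" "?I k s'" "var s' ''i'' = k" and fr: "frame (For ''i'' ''m'' ?c) s s'"
    have "input s'" by (rule input_frame[OF inp fr]) (simp_all add: command_defs)
    then have uv: "arr s' ''u'' = u" "arr s' ''v'' = v" by (simp_all add: input_def)
    have b': "var s' ''b'' = b" using fr by (simp add: frame_def b command_defs)
    have "?I (Suc k) (exec ?c s')"
      using k uv b' u_neq_v[OF k(1)] by (auto simp: D_Suc fun_eq_iff command_defs)
    then show "reach ?c s' (duration ?c) (?I (Suc k))"
      by (intro reach_straight) (simp_all add: command_defs)
  next
    fix s' assume I: "?I m s'"
    have "D m w = card {i. i < m \<and> (u i = b \<and> v i = w \<or> v i = b \<and> u i = w)}" for w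
    proof -
      have "{i. i < m \<and> (u i = b \<and> v i = w \<or> v i = b \<and> u i = w)} =
        {..<m} \<inter> {i. u i = b \<and> v i = w \<or> v i = b \<and> u i = w}" by auto
      then show ?thesis unfolding D_def by (simp only: sum_of_bool_eq finite_lessThan of_nat_id)
    qed
    then show "?Q s'" using I by simp
  qed (use inp in \<open>simp_all add: input_def command_defs D_def\<close>)
  then show ?thesis unfolding update_degrees_def by (rule reach_mono) (simp_all add: command_defs)
qed

text \<open>A round maintains in \<open>d\<close> the degrees among the unplaced vertices, so
  comparing \<open>d\<close> finds the vertex of minimal remaining degree that
  \<open>partial_greedy_step\<close> asks for.\<close>

lemma place_vertex_correct:
  fixes s :: state
  defines "\<pi> \<equiv> arr s ''pi''" and "h \<equiv> arr s ''h''" and "d \<equiv> arr s ''d''"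
  assumes inp: "input s" and r: "n - var s ''r'' = Suc r" and pg: "partial_greedy h \<pi> (Suc r)"
    and d: "\<forall>w<n. \<pi> w = 0 \<longrightarrow> d w = degree_upto \<pi> 0 w"
  shows "reach place_vertex s (n * 7 + m * 9 + 11) (\<lambda>s'. partial_greedy h (arr s' ''pi'') r \<and>
    (\<forall>w<n. arr s' ''pi'' w = 0 \<longrightarrow> arr s' ''d'' w = degree_upto (arr s' ''pi'') 0 w))"
    (is "reach _ _ _ ?Q")
proof -
  let ?store = "Store ''pi'' (Var ''b'') (Minus (Var ''n'') (Var ''r''))"
  let ?s = "set_var ''b'' n s"
  have inps: "input ?s" using inp by (simp add: input_def)
  have "reach select_vertex ?s (n * 7 + 3) (\<lambda>s'. reach (Seq ?store update_degrees) s' (1 + (m * 9 + 3) + 1) ?Q)"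
  proof (rule reach_mono[OF reach_frame[OF select_vertex_correct[OF inps]]])
    show "\<exists>w<n. arr ?s ''pi'' w = 0" using partial_greedy_unplaced[OF pg] r by (simp add: \<pi>_def)
    fix s' assume *: "(var s' ''b'' < n \<and> arr ?s ''pi'' (var s' ''b'') = 0 \<and>
      (\<forall>w<n. arr ?s ''pi'' w = 0 \<longrightarrow> arr ?s ''h'' (var s' ''b'') < arr ?s ''h'' w \<or>
        (arr ?s ''h'' (var s' ''b'') = arr ?s ''h'' w \<and> arr ?s ''d'' (var s' ''b'') \<le> arr ?s ''d'' w)))
      \<and> frame select_vertex ?s s'"
    define b where "b = var s' ''b''"
    have b: "b < n" "\<pi> b = 0" using * by (simp_all add: b_def \<pi>_def)
    have best: "h b < h w \<or> (h b = h w \<and> degree_upto \<pi> 0 b \<le> degree_upto \<pi> 0 w)" if "w < n" "\<pi> w = 0" for w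
    proof -
      have "h b < h w \<or> (h b = h w \<and> d b \<le> d w)" using * that by (simp add: b_def \<pi>_def h_def d_def)
      then show ?thesis using d that b by simp
    qed
    have fr: "frame select_vertex ?s s'" using * by simp
    have inp': "input s'" by (rule input_frame[OF inps fr]) (simp_all add: program_defs)
    have pi': "arr s' ''pi'' = \<pi>" and d': "arr s' ''d'' = d" and r': "var s' ''r'' = var s ''r''"
      using fr by (simp_all add: frame_def program_defs \<pi>_def d_def)
    let ?t = "set_arr ''pi'' b (Suc r) s'"
    have inpt: "input ?t" using inp' by (simp add: input_def)
    have "reach update_degrees ?t (m * 9 + 3) ?Q"
    proof (rule reach_mono[OF reach_frame[OF update_degrees_correct[OF inpt, of b]]])
      show "b = var ?t ''b''" by (simp add: b_def)
      fix s'' assume **: "arr s'' ''d'' = (\<lambda>w. arr ?t ''d'' w - card {i. i < m \<and> (u i = b \<and> v i = w \<or> v i = b \<and> u i = w)})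
        \<and> frame update_degrees ?t s''"
      have pi'': "arr s'' ''pi'' = \<pi>(b := Suc r)"
        using ** by (simp add: frame_def program_defs pi')
      have "partial_greedy h (\<pi>(b := Suc r)) r"
        by (rule partial_greedy_step[OF pg _ b best]) (use r in auto)
      moreover have "arr s'' ''d'' w = degree_upto (\<pi>(b := Suc r)) 0 w" if "w < n" "(\<pi>(b := Suc r)) w = 0" for w
      proof -
        have "w \<noteq> b" "\<pi> w = 0" using that by (auto split: if_splits)
        then show ?thesis using ** d that b by (simp add: degree_upto_0_step d')
      qed
      ultimately show "?Q s''" using pi'' by simp
    qed simp
    then have "reach ?store s' 1 (\<lambda>s''. reach update_degrees s'' (m * 9 + 3) ?Q)"
      using inp' r' r by (intro reach_Store) (simp add: b_def input_def)
    then show "reach (Seq ?store update_degrees) s' (1 + (m * 9 + 3) + 1) ?Q" by (rule reach_Seq)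
  qed simp_all
  from reach_Seq[OF this]
  have "reach (Assign ''b'' (Var ''n'')) s 1
    (\<lambda>s'. reach (Seq select_vertex (Seq ?store update_degrees)) s' (n * 7 + 3 + (1 + (m * 9 + 3) + 1) + 1) ?Q)"
    using inp by (intro reach_Assign) (simp add: input_def)
  from reach_Seq[OF this] show ?thesis unfolding place_vertex_def by (rule reach_mono) simp_all
qed

lemma place_vertices_correct:
  assumes inp: "input s" and pi: "arr s ''pi'' = (\<lambda>_. 0)" and d: "arr s ''d'' = degree_upto (\<lambda>_. 0) 0"
  shows "reach place_vertices s (n * (n * 7 + m * 9 + 15) + 3)
    (\<lambda>s'. bij_betw (arr s' ''pi'') {..<n} {1..n} \<and> greedy_order (arr s ''h'') (arr s' ''pi''))"
proof -
  let ?I = "\<lambda>k (s' :: state). partial_greedy (arr s ''h'') (arr s' ''pi'') (n - k) \<and>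
    (\<forall>w<n. arr s' ''pi'' w = 0 \<longrightarrow> arr s' ''d'' w = degree_upto (arr s' ''pi'') 0 w)"
  have "reach (For ''r'' ''n'' place_vertex) s (n * ((n * 7 + m * 9 + 11) + 4) + 3)
    (\<lambda>s'. bij_betw (arr s' ''pi'') {..<n} {1..n} \<and> greedy_order (arr s ''h'') (arr s' ''pi''))"
  proof (rule reach_For[where I = ?I])
    fix k s' assume k: "k < n" "?I k s'" "var s' ''r'' = k" and fr: "frame (For ''r'' ''n'' place_vertex) s s'"
    have inp': "input s'" by (rule input_frame[OF inp fr]) (simp_all add: program_defs)
    have h: "arr s' ''h'' = arr s ''h''" by (rule frame_arr[OF fr]) (simp add: program_defs)
    have r: "n - k = Suc (n - Suc k)" using k by simp
    show "reach place_vertex s' (n * 7 + m * 9 + 11) (?I (Suc k))"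
      using place_vertex_correct[OF inp', of "n - Suc k"] k h r by simp
  next
    fix s' assume "?I n s'"
    then have "partial_greedy (arr s ''h'') (arr s' ''pi'') 0" by simp
    then show "bij_betw (arr s' ''pi'') {..<n} {1..n} \<and> greedy_order (arr s ''h'') (arr s' ''pi'')"
      using partial_greedy_final by blast
  qed (use inp pi d partial_greedy_initial in \<open>simp_all add: input_def program_defs\<close>)
  then show ?thesis unfolding place_vertices_def by (rule reach_mono) simp_all
qed

lemma mlvc_algorithm_correct:
  assumes inp: "input s" and vars: "var s ''a'' = 0" "var s ''b'' = 0" "var s ''K'' = 0"
    and arrs: "\<And>a. a \<notin> {''u'', ''v''} \<Longrightarrow> arr s a = (\<lambda>_. 0)"
  shows "reach mlvc_algorithm s (step_bound n m (2 * n * (n + 1) * (n + 2) + 1)) (\<lambda>s'.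
    bij_betw (arr s' ''pi'') {..<n} {1..n} \<and>
    (\<forall>\<pi>'. bij_betw \<pi>' {..<n} {1..n} \<longrightarrow> 3 * cost (arr s' ''pi'') \<le> 4 * cost \<pi>'))"
    (is "reach _ _ _ ?Q")
proof -
  let ?K = "2 * n * (n + 1) * (n + 2) + 1"
  show ?thesis
    unfolding mlvc_algorithm_def step_bound_def
  proof (rule reach_Seq, rule reach_mono[OF reach_frame[OF compute_multiplicity_correct[OF inp vars]] order_refl],
      elim conjE)
    fix s1 assume K1: "var s1 ''K'' = ?K" and fr1: "frame compute_multiplicity s s1"
    have inp1: "input s1" by (rule input_frame[OF inp fr1]) (simp_all add: program_defs)
    have arrs1: "arr s1 = arr s" using fr1 by (auto simp: frame_def program_defs)
    show "reach (Seq init_loads (Seq balance (Seq compute_levels place_vertices))) s1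
      ((m * 11 + 3) + ((((m * ?K)\<^sup>2 * (m + 1) + m) * 23 + 3) +
       ((n * ((n * (n + 1) + n) * 7 + 11) + 3) + (n * (n * 7 + m * 9 + 15) + 3) + 1) + 1) + 1) ?Q"
    proof (rule reach_Seq, rule reach_mono[OF reach_frame[OF init_loads_correct[OF inp1]] order_refl],
        goal_cases l d y rest)
      case (rest s2)
      then have fr2: "frame init_loads s1 s2" by simp
      have inp2: "input s2" by (rule input_frame[OF inp1 fr2]) (simp_all add: program_defs)
      have y2: "arr s2 ''y'' = arr s1 ''y''" and pi2: "arr s2 ''pi'' = (\<lambda>_. 0)"
        using fr2 by (simp_all add: frame_def program_defs arrs1 arrs)
      have split2: "\<forall>i<m. arr s2 ''x'' i + arr s2 ''y'' i = ?K"
        using rest K1 by (simp add: y2 arrs1 arrs)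
      have load2: "arr s2 ''l'' = load (arr s2 ''x'') (arr s2 ''y'')" using rest y2 by simp
      have d2: "arr s2 ''d'' = degree_upto (\<lambda>_. 0) 0" using rest by simp
      show ?case
      proof (rule reach_Seq, rule reach_mono[OF reach_frame[OF balance_correct[OF inp2 split2 load2]] order_refl],
          elim conjE)
        fix s3 assume fr3: "frame balance s2 s3"
          and split3: "\<forall>i<m. arr s3 ''x'' i + arr s3 ''y'' i = ?K"
          and load3: "arr s3 ''l'' = load (arr s3 ''x'') (arr s3 ''y'')"
          and stable3: "\<forall>i<m. stable (arr s3 ''l'') (arr s3 ''x'') (arr s3 ''y'') i"
        have inp3: "input s3" by (rule input_frame[OF inp2 fr3]) (simp_all add: program_defs)
        have d3: "arr s3 ''d'' = degree_upto (\<lambda>_. 0) 0" "arr s3 ''pi'' = (\<lambda>_. 0)"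
          using fr3 d2 pi2 by (simp_all add: frame_def program_defs)
        show "reach (Seq compute_levels place_vertices) s3
          ((n * ((n * (n + 1) + n) * 7 + 11) + 3) + (n * (n * 7 + m * 9 + 15) + 3) + 1) ?Q"
        proof (rule reach_Seq, rule reach_mono[OF reach_frame[OF compute_levels_correct[OF inp3]] order_refl],
            elim conjE)
          fix s4 assume fr4: "frame compute_levels s3 s4"
            and level: "\<forall>w<n. gap_level (arr s3 ''l'') w (arr s4 ''h'' w)"
          have inp4: "input s4" by (rule input_frame[OF inp3 fr4]) (simp_all add: program_defs)
          have d4: "arr s4 ''pi'' = (\<lambda>_. 0)" "arr s4 ''d'' = degree_upto (\<lambda>_. 0) 0"
            using fr4 d3 by (simp_all add: frame_def program_defs)
          show "reach place_vertices s4 (n * (n * 7 + m * 9 + 15) + 3) ?Q"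
          proof (rule reach_mono[OF place_vertices_correct[OF inp4 d4] order_refl], elim conjE)
            fix s5 :: state assume bij: "bij_betw (arr s5 ''pi'') {..<n} {1..n}"
              and greedy: "greedy_order (arr s4 ''h'') (arr s5 ''pi'')"
            \<comment> \<open>The summand 1 of the multiplicity keeps this strict for
              \<open>n = 0\<close>.\<close>
            have K: "2 * n * n * (n + 1) < ?K" by (simp add: algebra_simps)
            have "3 * cost (arr s5 ''pi'') \<le> 4 * cost \<pi>'" if "bij_betw \<pi>' {..<n} {1..n}" for \<pi>'
              by (rule greedy_approximation[OF bij greedy _ _ _ K that, of "arr s3 ''x''" "arr s3 ''y''"])
                (use split3 stable3 level in \<open>simp_all add: load3[symmetric]\<close>)
            then show "?Q s5" using bij by blast
          qed
        qed
      qed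
    qed (simp_all add: arrs1 arrs)
  qed
qed

end

section \<open>Polynomial step bound and transfer to graphs\<close>

lemma step_bound_mono:
  "n \<le> n' \<Longrightarrow> m \<le> m' \<Longrightarrow> K \<le> K' \<Longrightarrow> step_bound n m K \<le> step_bound n' m' K'"
  unfolding step_bound_def by (intro add_mono mult_mono power_mono order_refl) auto

text \<open>By monotonicity both \<open>n\<close> and \<open>m\<close> may be raised to
  \<open>n + m\<close>, which leaves a polynomial in one variable.\<close>

lemma step_bound_polynomial:
  "\<exists>p :: nat poly. \<forall>n m. step_bound n m (2 * n * (n + 1) * (n + 2) + 1) \<le> poly p (n + m)"
proof -
  define X :: "nat poly" where "X = [:0, 1:]"
  define K where "K = [:2:] * X * (X + 1) * (X + [:2:]) + 1"
  define p where "p = (X * [:9:] + [:5:]) + ((X * [:11:] + [:3:]) + ((((X * K)\<^sup>2 * (X + 1) + X) * [:23:] + [:3:]) +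
     ((X * ((X * (X + 1) + X) * [:7:] + [:11:]) + [:3:]) + (X * (X * [:7:] + X * [:9:] + [:15:]) + [:3:]) + 1) + 1) + 1) + 1"
  have X: "poly X N = N" for N by (simp add: X_def)
  have K: "poly K N = 2 * N * (N + 1) * (N + 2) + 1" for N by (simp add: K_def X)
  have p: "poly p N = step_bound N N (2 * N * (N + 1) * (N + 2) + 1)" for N
    by (simp add: p_def X K step_bound_def poly_power mult.commute)
  have "step_bound n m (2 * n * (n + 1) * (n + 2) + 1) \<le> poly p (n + m)" for n m
    unfolding p by (intro step_bound_mono add_mono mult_mono) auto
  then show ?thesis by blast
qed

lemma mlvc_cost_list:
  assumes "lists_edges es E"
  shows "mlvc_cost E \<pi> = (\<Sum>i<length es. max (\<pi> (fst (es ! i))) (\<pi> (snd (es ! i))))"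
proof -
  let ?f = "\<lambda>(u, v). {u, v}"
  have "mlvc_cost E \<pi> = (\<Sum>e\<in>set (map ?f es). Max (\<pi> ` e))"
    using assms by (simp add: mlvc_cost_def lists_edges_def)
  also have "\<dots> = sum_list (map (\<lambda>e. Max (\<pi> ` e)) (map ?f es))"
    by (rule sum.distinct_set_conv_list) (use assms in \<open>simp add: lists_edges_def\<close>)
  also have "\<dots> = (\<Sum>i<length es. max (\<pi> (fst (es ! i))) (\<pi> (snd (es ! i))))"
    unfolding sum_list_sum_nth by (simp add: atLeast0LessThan case_prod_unfold)
  finally show ?thesis .
qed

text \<open>A nonempty set of naturals contains its infimum; \<open>Suc\<close> witnesses that
  solutions exist.\<close>

lemma mlvc_opt_attained:
  fixes n :: nat
  obtains \<pi> where "mlvc_solution {..<n} \<pi>" "mlvc_opt {..<n} E = mlvc_cost E \<pi>"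
proof -
  have "bij_betw Suc {..<n} {1..n}" by (auto simp: bij_betw_def image_Suc_lessThan)
  then have "mlvc_cost E ` {\<pi>. mlvc_solution {..<n} \<pi>} \<noteq> {}"
    unfolding mlvc_solution_def card_lessThan by blast
  from Inf_nat_def1[OF this] show ?thesis using that by (auto simp: mlvc_opt_def)
qed

theorem theorem6: "\<exists>c. randomized_mlvc_approximation (4/3) c"
proof -
  obtain p :: "nat poly" where p: "\<And>n m. step_bound n m (2 * n * (n + 1) * (n + 2) + 1) \<le> poly p (n + m)"
    using step_bound_polynomial by blast
  have "randomized_mlvc_approximation (4/3) mlvc_algorithm"
    unfolding randomized_mlvc_approximation_def Let_def
  proof (intro exI[of _ p] allI impI)
    fix n E es assume graph: "simple_graph {..<n} E" and es: "lists_edges es E"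
    \<comment> \<open>The default 0 beyond \<open>m\<close> matches \<open>input_state\<close>, so
      the arrays equal \<open>u\<close> and \<open>v\<close> as total functions.\<close>
    define m u v where "m = length es"
      and "u = (\<lambda>i. if i < m then fst (es ! i) else 0)" and "v = (\<lambda>i. if i < m then snd (es ! i) else 0)"
    have edge: "{u i, v i} \<subseteq> {..<n} \<and> card {u i, v i} = 2" if "i < m" for i
    proof -
      have "(case es ! i of (u, v) \<Rightarrow> {u, v}) \<in> E"
        using es that by (auto simp: lists_edges_def m_def)
      then have "{u i, v i} \<in> E" using that by (simp add: u_def v_def case_prod_unfold)
      then show ?thesis using graph by (auto simp: simple_graph_def)
    qed
    interpret edge_list n m u v
      by unfold_locales (use edge in \<open>fastforce+\<close>)
    let ?s = "input_state n es"
    have cost: "cost \<pi> = mlvc_cost E \<pi>" for \<pi>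
      unfolding mlvc_cost_list[OF es] cost_def by (simp add: u_def v_def m_def)
    have "input ?s" unfolding input_def by (simp add: input_state_def u_def v_def m_def)
    then have "reach mlvc_algorithm ?s (step_bound n m (2 * n * (n + 1) * (n + 2) + 1)) (\<lambda>s'.
      bij_betw (arr s' ''pi'') {..<n} {1..n} \<and>
      (\<forall>\<pi>'. bij_betw \<pi>' {..<n} {1..n} \<longrightarrow> 3 * cost (arr s' ''pi'') \<le> 4 * cost \<pi>'))"
      by (rule mlvc_algorithm_correct) (auto simp: input_state_def)
    then have "reach mlvc_algorithm ?s (poly p (n + length es)) (\<lambda>s'.
      bij_betw (arr s' ''pi'') {..<n} {1..n} \<and>
      (\<forall>\<pi>'. bij_betw \<pi>' {..<n} {1..n} \<longrightarrow> 3 * cost (arr s' ''pi'') \<le> 4 * cost \<pi>'))"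
      by (rule reach_mono) (use p in \<open>simp_all add: m_def\<close>)
    then obtain s' where run: "run (poly p (n + length es)) (mlvc_algorithm, ?s) = return_pmf (SKIP, s')"
      and bij: "bij_betw (arr s' ''pi'') {..<n} {1..n}"
      and le: "\<And>\<pi>'. bij_betw \<pi>' {..<n} {1..n} \<Longrightarrow> 3 * cost (arr s' ''pi'') \<le> 4 * cost \<pi>'"
      by (rule reach_run) blast
    obtain \<pi> where \<pi>: "mlvc_solution {..<n} \<pi>" "mlvc_opt {..<n} E = mlvc_cost E \<pi>"
      by (rule mlvc_opt_attained)
    then have "3 * mlvc_cost E (arr s' ''pi'') \<le> 4 * mlvc_opt {..<n} E"
      using le[of \<pi>] by (simp add: mlvc_solution_def cost)
    then have "3 * real (mlvc_cost E (arr s' ''pi'')) \<le> 4 * real (mlvc_opt {..<n} E)"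
      by (metis of_nat_mono of_nat_mult of_nat_numeral)
    then show "(\<forall>cfg\<in>set_pmf (run (poly p (n + length es)) (mlvc_algorithm, ?s)).
        fst cfg = SKIP \<and> mlvc_solution {..<n} (computed_order cfg)) \<and>
      measure_pmf.expectation (run (poly p (n + length es)) (mlvc_algorithm, ?s))
        (\<lambda>cfg. real (mlvc_cost E (computed_order cfg))) \<le> 4 / 3 * real (mlvc_opt {..<n} E)"
      \<comment> \<open>The run is a point mass, so its support is a single configuration and the
        expectation is the cost there.\<close>
      unfolding run using bij by (simp add: computed_order_def mlvc_solution_def)
  qed
  then show ?thesis by blast
qed

end
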